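(* Let $\boldsymbol{P}=\boldsymbol{P}_{\rm s}+\boldsymbol{P}_{\rm i}\epsilon$ denote an $n\times n$ dual transitional probability matrix (DTPM). With maxima and minima taken over all $n\times n$ DTPMs in the total order on dual numbers, the dual-valued Schatten $p$-norm $\Vert\boldsymbol{P}\Vert_{S_p}$ satisfies: (i) for $1\le p<2$, $\max_{\boldsymbol{P}}\Vert\boldsymbol{P}\Vert_{S_p}=n^{1/p}$, attained if and only if $\boldsymbol{P}$ is a permutation matrix; (ii) $\max_{\boldsymbol{P}}\Vert\boldsymbol{P}\Vert_{S_2}=n^{1/2}$, attained if and only if each column of $\boldsymbol{P}$ is a one-hot vector; (iii) for $2<p\le\infty$, $\max_{\boldsymbol{P}}\Vert\boldsymbol{P}\Vert_{S_p}=n^{1/2}$, attained if and only if $\boldsymbol{P}$ consists of identical one-hot (column) vectors; (iv) $\min_{\boldsymbol{P}}\Vert\boldsymbol{P}\Vert_{S_1}=1$, attained if and only if $\boldsymbol{P}=\frac1n\mathbf{1}\mathbf{1}^\top+\boldsymbol{w}\mathbf{1}^\top\epsilon$ for some (arbitrary) $\boldsymbol{w}\in\mathbb{R}^n$ with $\mathbf{1}^\top\boldsymbol{w}=0$; (v) for $1<p\le\infty$, $\min_{\boldsymbol{P}}\Vert\boldsymbol{P}\Vert_{S_p}=1$, attained if and only if $\boldsymbol{P}=\frac1n\mathbf{1}\mathbf{1}^\top+\boldsymbol{P}_{\rm i}\epsilon$ for some (arbitrary) $\boldsymbol{P}_{\rm i}\in\mathbb{R}^{n\times n}$ with $\mathbf{1}^\top\boldsymbol{P}_{\rm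 i}=\boldsymbol{0}^\top$.
   Context: Dual numbers: $\mathbb{DR}=\{p_{\rm s}+p_{\rm i}\epsilon: p_{\rm s},p_{\rm i}\in\mathbb{R}\}$ with $\epsilon\neq0$, $\epsilon^2=0$ (a commutative ring), with total order $p<q$ if $p_{\rm s}<q_{\rm s}$, or $p_{\rm s}=q_{\rm s}$ and $p_{\rm i}<q_{\rm i}$. Dual matrices are written $\boldsymbol{P}=\boldsymbol{P}_{\rm s}+\boldsymbol{P}_{\rm i}\epsilon$ with real $\boldsymbol{P}_{\rm s},\boldsymbol{P}_{\rm i}$. $\mathbf{1}$ is the all-ones vector in $\mathbb{R}^n$. An $n\times n$ DTPM is a dual matrix $\boldsymbol{P}\in\mathbb{DR}^{n\times n}$ all of whose entries are $\ge0$ in the total order and with $\mathbf{1}^\top\boldsymbol{P}=\mathbf{1}^\top$. A DTPM is called a permutation matrix if $\boldsymbol{P}_{\rm s}$ is a permutation matrix and $\boldsymbol{P}_{\rm i}=\boldsymbol{O}$. A one-hot vector is a real vector with a single entry equal to $1$ and all other entries equal to $0$. Gâteaux derivative: $\mathcal{D}_u\phi(x)=\lim_{t\downarrow0}\frac{\phi(x+tu)-\phi(x)}{t}$. The dual continuation of a real-valued function $\phi$ on a real space $\mathcal{X}$ is $\tilde\phi(a+b\epsilon)=\phi(a)+\mathcal{D}_b\phi(a)\,\epsilon$ for $a,b\in\mathcal{X}$. The dual-valued Schatten $p$-norm $\Vert\cdot\Vert_{S_p}$ on $\mathbb{DR}^{n\times n}$ is the dual continuation of the real Schatten $p$-norm,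 $\Vert\boldsymbol{X}\Vert_{S_p}=(\sum_i\sigma_i(\boldsymbol{X})^p)^{1/p}$ for $1\le p<\infty$ and $\Vert\boldsymbol{X}\Vert_{S_\infty}=\max_i\sigma_i(\boldsymbol{X})$, where $\sigma_i(\boldsymbol{X})$ are the singular values.
   Formalization: In (v) the "only if" part is stated only for 1 < p < ∞; at p = ∞ it is false for n ≥ 2, since the identity matrix is a DTPM with norm 1. The minimum value 1 and the "if" part are kept for p = ∞. *)

theory Defs
  imports "HOL-Analysis.Analysis" "HOL-Computational_Algebra.Computational_Algebra"
begin

section \<open>Dual numbers\<close>

text \<open>\<open>Dual a b\<close> is the dual number \<open>a + b \<epsilon>\<close>.\<close>

datatype dual = Dual (std_part: real) (inf_part: real)

lemma dual_eq_iff: "p = q \<longleftrightarrow> std_part p = std_part q \<and> inf_part p = inf_part q"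
  by (cases p; cases q) simp

instantiation dual :: comm_ring_1
begin

definition "0 = Dual 0 0"
definition "1 = Dual 1 0"
definition "p + q = Dual (std_part p + std_part q) (inf_part p + inf_part q)"
definition "p - q = Dual (std_part p - std_part q) (inf_part p - inf_part q)"
definition "- p = Dual (- std_part p) (- inf_part p)"
definition "p * q = Dual (std_part p * std_part q)
                         (std_part p * inf_part q + inf_part p * std_part q)"

instance
  by standard
     (auto simp: zero_dual_def one_dual_def plus_dual_def minus_dual_def uminus_dual_def
        times_dual_def algebra_simps)

end

instantiation dual :: linorder
begin

definition less_dual :: "dual \<Rightarrow> dual \<Rightarrow> bool" where
  "p < q \<longleftrightarrow> std_part p < std_part q \<or> std_part p = std_part q \<and> inf_part p < inf_part q"
definition less_eq_dual :: "dual \<Rightarrow> dual \<Rightarrow> bool" where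
  "p \<le> q \<longleftrightarrow> p < q \<or> p = (q :: dual)"

instance
  by standard (auto simp: less_dual_def less_eq_dual_def dual_eq_iff)

end

section \<open>Dual vectors and matrices\<close>

text \<open>\<open>dual_vec a b\<close> and \<open>dual_mat A B\<close> are \<open>a + b \<epsilon>\<close> and \<open>A + B \<epsilon>\<close> for real \<open>a, b, A, B\<close>.\<close>

definition dual_vec :: "real^'n \<Rightarrow> real^'n \<Rightarrow> dual^'n" where
  "dual_vec a b = (\<chi> i. Dual (a $ i) (b $ i))"

definition dual_mat :: "real^'n^'m \<Rightarrow> real^'n^'m \<Rightarrow> dual^'n^'m" where
  "dual_mat A B = (\<chi> i j. Dual (A $ i $ j) (B $ i $ j))"

abbreviation std_mat :: "dual^'n^'m \<Rightarrow> real^'n^'m" where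
  "std_mat \<equiv> map_matrix std_part"

abbreviation inf_mat :: "dual^'n^'m \<Rightarrow> real^'n^'m" where
  "inf_mat \<equiv> map_matrix inf_part"

text \<open>The vector \<open>1\<close> of the library is the all-ones vector, so \<open>1 v* P = 1\<close> says that every column
  of \<open>P\<close> sums to one.\<close>

definition is_dtpm :: "dual^'n^'n \<Rightarrow> bool" where
  "is_dtpm P \<longleftrightarrow> (\<forall>i j. P $ i $ j \<ge> 0) \<and> 1 v* P = 1"

definition is_permutation_matrix :: "real^'n^'n \<Rightarrow> bool" where
  "is_permutation_matrix A \<longleftrightarrow>
     (\<exists>\<pi>. \<pi> permutes UNIV \<and> A = (\<chi> i j. if i = \<pi> j then 1 else 0))"

definition is_permutation_dtpm :: "dual^'n^'n \<Rightarrow> bool" where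
  "is_permutation_dtpm P \<longleftrightarrow>
     is_dtpm P \<and> is_permutation_matrix (std_mat P) \<and> inf_mat P = 0"

definition one_hot :: "real^'n \<Rightarrow> bool" where
  "one_hot x \<longleftrightarrow> (\<exists>i. x $ i = 1 \<and> (\<forall>j. j \<noteq> i \<longrightarrow> x $ j = 0))"

definition outer :: "real^'m \<Rightarrow> real^'n \<Rightarrow> real^'n^'m" where
  "outer x y = (\<chi> i j. x $ i * y $ j)"

section \<open>Schatten norms\<close>

definition charpoly :: "real^'n^'n \<Rightarrow> real poly" where
  "charpoly A = det (\<chi> i j. (if i = j then [:0, 1:] else 0) - [:A $ i $ j:])"

text \<open>The singular values of \<open>X\<close>, with multiplicity: the square roots of the eigenvalues of
  \<open>X\<^sup>T X\<close>. That matrix is symmetric and positive semidefinite, so its characteristic polynomial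
  has \<open>n\<close> real roots, all nonnegative.\<close>

definition singular_values :: "real^'n^'n \<Rightarrow> real multiset" where
  "singular_values X = image_mset sqrt (proots (charpoly (transpose X ** X)))"

text \<open>Meant for \<open>1 \<le> p \<le> \<infinity>\<close>.\<close>

definition schatten_norm :: "ereal \<Rightarrow> real^'n^'n \<Rightarrow> real" where
  "schatten_norm p X =
     (if p = \<infinity> then Max (set_mset (singular_values X))
      else (\<Sum>s\<in>#singular_values X. s powr real_of_ereal p) powr (1 / real_of_ereal p))"

definition gateaux_derivative :: "('a::real_vector \<Rightarrow> real) \<Rightarrow> 'a \<Rightarrow> 'a \<Rightarrow> real" where
  "gateaux_derivative \<phi> x u = Lim (at_right 0) (\<lambda>t. (\<phi> (x + t *\<^sub>R u) - \<phi> x) / t)"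

text \<open>\<open>dual_continuation \<phi> a b\<close> is the value of the dual continuation of \<open>\<phi>\<close> at \<open>a + b \<epsilon>\<close>.\<close>

definition dual_continuation :: "('a::real_vector \<Rightarrow> real) \<Rightarrow> 'a \<Rightarrow> 'a \<Rightarrow> dual" where
  "dual_continuation \<phi> a b = Dual (\<phi> a) (gateaux_derivative \<phi> a b)"

definition dual_schatten_norm :: "ereal \<Rightarrow> dual^'n^'n \<Rightarrow> dual" where
  "dual_schatten_norm p P = dual_continuation (schatten_norm p) (std_mat P) (inf_mat P)"

section \<open>Attained extrema\<close>

definition has_max :: "('b \<Rightarrow> 'a::linorder) \<Rightarrow> ('b \<Rightarrow> bool) \<Rightarrow> 'a \<Rightarrow> bool" where
  "has_max f S c \<longleftrightarrow> (\<exists>x. is_arg_max f S x \<and> f x = c)"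

definition has_min :: "('b \<Rightarrow> 'a::linorder) \<Rightarrow> ('b \<Rightarrow> bool) \<Rightarrow> 'a \<Rightarrow> bool" where
  "has_min f S c \<longleftrightarrow> (\<exists>x. is_arg_min f S x \<and> f x = c)"

section \<open>The minimizers of the Schatten infinity-norm are not unique\<close>

text \<open>The identity matrix is a DTPM whose dual-valued Schatten \<open>\<infinity>\<close>-norm is 1, the minimum value.
  Hence for \<open>p = \<infinity>\<close> and \<open>n \<ge> 2\<close> the minimum is not only attained by matrices with standard part
  \<open>(1/n) 1 1\<^sup>T\<close>.\<close>

lemma zero_le_one_dual: "0 \<le> (1 :: dual)"
  by (simp add: less_eq_dual_def less_dual_def zero_dual_def one_dual_def)

lemma is_dtpm_identity: "is_dtpm (mat 1 :: dual^'n^'n)"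
  unfolding is_dtpm_def vector_matrix_mult_def
  by (auto simp: vec_eq_iff mat_def zero_le_one_dual if_distrib
      cong: if_cong)

lemma dual_schatten_norm_identity: "dual_schatten_norm \<infinity> (mat 1 :: dual^'n^'n) = Dual 1 0"
proof -
  have s: "std_mat (mat 1 :: dual^'n^'n) = mat 1" and i: "inf_mat (mat 1 :: dual^'n^'n) = 0"
    by (auto simp: vec_eq_iff mat_def zero_dual_def one_dual_def)
  have "charpoly (mat 1 :: real^'n^'n) = [:-1, 1:] ^ CARD('n)"
    unfolding charpoly_def by (subst det_diagonal) (auto simp: mat_def)
  then have "singular_values (mat 1 :: real^'n^'n) =
      image_mset sqrt (repeat_mset CARD('n) {#1#})"
    by (simp add: singular_values_def proots_power)
  then have "set_mset (singular_values (mat 1 :: real^'n^'n)) = {1}"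
    by simp
  then have "schatten_norm \<infinity> (mat 1 :: real^'n^'n) = 1"
    by (simp add: schatten_norm_def)
  moreover have "Lim (at_right 0) (\<lambda>t::real. 0::real) = 0"
    by (intro tendsto_Lim) auto
  ultimately show ?thesis
    by (simp add: dual_schatten_norm_def dual_continuation_def gateaux_derivative_def s i)
qed

lemma identity_attains_min_infinity:
  assumes "has_min (dual_schatten_norm \<infinity>) (is_dtpm :: dual^'n^'n \<Rightarrow> bool) (Dual 1 0)"
  shows "is_arg_min (dual_schatten_norm \<infinity>) is_dtpm (mat 1 :: dual^'n^'n)"
  using assms is_dtpm_identity dual_schatten_norm_identity
  unfolding has_min_def is_arg_min_def by metis

lemma identity_not_uniform:
  assumes "CARD('n) \<ge> 2"
  shows "(mat 1 :: dual^'n^'n) \<noteq> dual_mat ((1 / real CARD('n)) *\<^sub>R outer 1 1) B"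
proof
  fix i :: 'n
  assume "(mat 1 :: dual^'n^'n) = dual_mat ((1 / real CARD('n)) *\<^sub>R outer 1 1) B"
  then have "(mat 1 :: dual^'n^'n) $ i $ i = dual_mat ((1 / real CARD('n)) *\<^sub>R outer 1 1) B $ i $ i"
    by simp
  with assms show False
    by (simp add: mat_def dual_mat_def outer_def one_dual_def)
qed

end

theory Submission
  imports Defs "HOL-Real_Asymp.Real_Asymp"
begin

text \<open>
  Dual numbers are ordered lexicographically. So a dual matrix \<open>S + B \<epsilon>\<close> is extremal if and only if
  its standard part \<open>S\<close> is extremal for the real Schatten norm and the derivative at \<open>S\<close> along its
  infinitesimal part \<open>B\<close> is extremal among all such \<open>S\<close> and the directions that they admit. Throughout,
  \<open>F\<close> is the Frobenius norm, \<open>M\<close> the operator norm (the Schatten \<open>\<infinity>\<close>-norm), \<open>n\<close> the size of the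
  matrices and \<open>J\<close> the uniform matrix with all entries \<open>1 / n\<close>.

  Maxima of the real norm. A column-stochastic matrix has \<open>F \<le> sqrt n\<close>, with equality exactly for
  one-hot columns (\<open>col_stochastic_frobenius\<close>). For \<open>p = 2\<close> this is the claim. For \<open>p < 2\<close> the
  tangent inequality for \<open>y\<^bsup>p/2\<^esup>\<close> bounds the sum of the \<open>p\<close>-th powers of the singular values by
  \<open>n + (p/2) (F\<^sup>2 - n) \<le> n\<close>; equality makes all singular values \<open>1\<close>, so the matrix is orthogonal and
  hence a permutation matrix. For \<open>p > 2\<close> the Schatten norm is at most \<open>F\<close>; equality makes the
  matrix rank one, so its one-hot columns coincide.

  Maxima of the derivative. In all three cases the derivative of the norm at a maximizer is a
  positive multiple of \<open>S \<bullet> B\<close>. An entry of \<open>B\<close> where \<open>S\<close> is \<open>0\<close> is nonnegative and the columns of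
  \<open>B\<close> add up to \<open>0\<close>, so the entries where \<open>S\<close> is \<open>1\<close> are nonpositive: \<open>S \<bullet> B \<le> 0\<close>, with equality
  only for \<open>B = 0\<close> (\<open>selection_matrix_feasible_direction\<close>).

  Minima of the real norm. Column sums \<open>1\<close> give \<open>M \<ge> 1\<close>, by testing on the all-ones vector, and
  every Schatten norm is at least \<open>M\<close>. If \<open>p < \<infinity>\<close> and the norm is \<open>1\<close>, there is a single nonzero
  singular value, equal to \<open>1\<close>, so \<open>F = 1 = S \<bullet> J\<close> and \<open>S = J\<close>.

  Minima of the derivative. Moving along \<open>B\<close> keeps the column sums, so the norm stays at least \<open>1\<close>
  and the derivative is nonnegative. At \<open>J\<close> and for \<open>p > 1\<close> it is \<open>0\<close>, because the largest
  singular value is \<open>1 + O(t\<^sup>2)\<close> and the others are of order \<open>t\<close> and enter with the power \<open>p\<close>. For \<open>p = 1\<close> they enter to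
  first order, and the derivative is \<open>0\<close> if and only if \<open>B (1 - J) = 0\<close>, that is, \<open>B = w 1\<^sup>T\<close> for some \<open>w\<close>.

  Directional derivatives are limits whose existence has to be proved. They come either from a
  squeeze between explicit bounds with a common slope (\<open>gateaux_derivative_squeeze\<close>), the lower ones
  obtained by pairing with a fixed contraction or with a fixed pair of singular vectors, or from
  convexity (\<open>convex_gateaux_derivative_ge\<close>). The singular values themselves, defined through the
  roots of a characteristic polynomial, are made accessible by the spectral theorem for symmetric
  matrices, proved here with Rayleigh quotients.
\<close>

(* Otherwise the dollar sign for vector components would also be read as a power series coefficient. *)
unbundle no fps_syntax

section \<open>Orthonormal families and Parseval's identity\<close>

definition orthonormal_family :: "('n \<Rightarrow> real^'n) \<Rightarrow> bool" where
  "orthonormal_family v \<longleftrightarrow> (\<forall>i j. v i \<bullet> v j = (if i = j then 1 else 0))"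

lemma orthonormal_family_inner:
  "orthonormal_family v \<Longrightarrow> v i \<bullet> v j = (if i = j then 1 else 0)"
  by (simp add: orthonormal_family_def)

lemma orthonormal_family_norm: "orthonormal_family v \<Longrightarrow> norm (v i) = 1"
  by (simp add: norm_eq_1 orthonormal_family_inner)

text \<open>Collected as the columns of a matrix \<open>Q\<close>, the family satisfies \<open>Q\<^sup>T Q = 1\<close>; since \<open>Q\<close> is
  square, also \<open>Q Q\<^sup>T = 1\<close>, and that identity is Parseval's.\<close>

lemma orthonormal_family_matrix:
  fixes v :: "'n \<Rightarrow> real^'n"
  assumes "orthonormal_family v"
  defines "Q \<equiv> (\<chi> a i. v i $ a)"
  shows "transpose Q ** Q = mat 1" "Q ** transpose Q = mat 1" "transpose Q *v x = (\<chi> i. x \<bullet> v i)"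
proof -
  show *: "transpose Q ** Q = mat 1"
    using assms
    by (simp add: vec_eq_iff matrix_matrix_mult_def transpose_def mat_def inner_vec_def
        orthonormal_family_def)
  then show "Q ** transpose Q = mat 1"
    by (simp add: matrix_left_right_inverse)
  show "transpose Q *v x = (\<chi> i. x \<bullet> v i)"
    by (simp add: vec_eq_iff matrix_vector_mult_def transpose_def inner_vec_def Q_def mult.commute)
qed

lemma parseval:
  fixes v :: "'n \<Rightarrow> real^'n"
  assumes "orthonormal_family v"
  shows "(\<Sum>i\<in>UNIV. (x \<bullet> v i) * (y \<bullet> v i)) = x \<bullet> y"
proof -
  define Q :: "real^'n^'n" where "Q = (\<chi> a i. v i $ a)"
  note Q = orthonormal_family_matrix[OF assms, folded Q_def]
  have "(\<Sum>i\<in>UNIV. (x \<bullet> v i) * (y \<bullet> v i)) = (transpose Q *v x) \<bullet> (transpose Q *v y)"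
    unfolding Q(3) by (simp add: inner_vec_def)
  also have "\<dots> = x \<bullet> (Q *v (transpose Q *v y))"
    by (metis dot_lmul_matrix transpose_matrix_vector)
  also have "\<dots> = x \<bullet> y"
    by (simp add: matrix_vector_mul_assoc Q(2) del: transpose_matrix_vector)
  finally show ?thesis .
qed

lemma parseval_norm:
  fixes v :: "'n \<Rightarrow> real^'n"
  assumes "orthonormal_family v"
  shows "(\<Sum>i\<in>UNIV. (x \<bullet> v i)\<^sup>2) = (norm x)\<^sup>2"
  using parseval[OF assms, of x x] by (simp add: power2_eq_square flip: power2_norm_eq_inner)

lemma orthonormal_family_expand:
  fixes v :: "'n \<Rightarrow> real^'n"
  assumes "orthonormal_family v"
  shows "(\<Sum>i\<in>UNIV. (x \<bullet> v i) *\<^sub>R v i) = x"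
proof (rule vector_eq_rdot[THEN iffD1], rule allI)
  show "(\<Sum>i\<in>UNIV. (x \<bullet> v i) *\<^sub>R v i) \<bullet> z = x \<bullet> z" for z
    using parseval[OF assms, of x z] by (simp add: inner_sum_left inner_commute[of z])
qed

text \<open>The inner product on \<open>real^'n^'n\<close> is the Frobenius inner product \<open>tr (A\<^sup>T B)\<close>, and the
  norm is the Frobenius norm. Both are sums over rows, so Parseval applied to each row makes them
  computable in any orthonormal family; with right singular vectors this links entries to singular
  values.\<close>

lemma frobenius_inner_orthonormal:
  fixes A B :: "real^'n^'n"
  assumes "orthonormal_family v"
  shows "(\<Sum>i\<in>UNIV. (A *v v i) \<bullet> (B *v v i)) = A \<bullet> B"
proof -
  have "(\<Sum>i\<in>UNIV. (A *v v i) \<bullet> (B *v v i))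
      = (\<Sum>i\<in>UNIV. \<Sum>k\<in>UNIV. (A $ k \<bullet> v i) * (B $ k \<bullet> v i))"
    by (simp add: inner_vec_def matrix_vector_mult_def)
  also have "\<dots> = (\<Sum>k\<in>UNIV. \<Sum>i\<in>UNIV. (A $ k \<bullet> v i) * (B $ k \<bullet> v i))"
    by (rule sum.swap)
  also have "\<dots> = A \<bullet> B"
    by (simp add: parseval[OF assms] inner_vec_def[where 'a = "real^'n"])
  finally show ?thesis .
qed

section \<open>The spectral theorem for symmetric matrices\<close>

lemma symmetric_inner:
  fixes A :: "real^'n^'n"
  assumes "transpose A = A"
  shows "(A *v x) \<bullet> y = x \<bullet> (A *v y)"
  by (metis assms dot_lmul_matrix transpose_matrix_vector)

text \<open>The first-order condition for a minimum at \<open>t = 0\<close>.\<close>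

lemma nonneg_quadratic_linear_coeff:
  fixes a b :: real
  assumes "\<And>t. 0 \<le> 2 * t * a + t\<^sup>2 * b"
  shows "a = 0"
proof (rule ccontr)
  assume "a \<noteq> 0"
  define c where "c = \<bar>b\<bar> + 1"
  have c: "c > 0" "b \<le> c" "b < c" by (auto simp: c_def)
  \<comment> \<open>A small step against the slope: at this \<open>t\<close> the linear term outweighs the quadratic one.\<close>
  have "0 \<le> 2 * (- (a / c)) * a + (- (a / c))\<^sup>2 * b" by (rule assms)
  also have "\<dots> \<le> 2 * (- (a / c)) * a + (a / c)\<^sup>2 * c"
    using c by (simp add: mult_left_mono)
  also have "\<dots> = - (a\<^sup>2 / c)"
    using c by (simp add: power2_eq_square field_simps)
  also have "\<dots> < 0" using \<open>a \<noteq> 0\<close> c by simp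
  finally show False by simp
qed

text \<open>Rayleigh's argument. On the unit sphere of the subspace the form \<open>x \<bullet> (A x)\<close> attains a maximum
  \<open>l\<close> at some \<open>v\<close>. Then \<open>l (x \<bullet> x) - x \<bullet> (A x)\<close> is nonnegative on the subspace and vanishes at
  \<open>v\<close>, so its derivative at \<open>v\<close> vanishes: \<open>l v - A v\<close> is orthogonal to the subspace. By invariance
  it also lies in the subspace, hence is zero.\<close>

lemma symmetric_eigenvector_in_subspace:
  fixes A :: "real^'n^'n"
  assumes sym: "transpose A = A" and S: "subspace S" "S \<noteq> {0}"
    and inv: "\<And>x. x \<in> S \<Longrightarrow> A *v x \<in> S"
  obtains v l where "v \<in> S" "norm v = 1" "A *v v = l *\<^sub>R v"
proof -
  define K where "K = S \<inter> sphere 0 1"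
  have "compact K"
    unfolding K_def using S(1) by (intro closed_Int_compact closed_subspace) auto
  moreover obtain x where x: "x \<in> S" "x \<noteq> 0"
    using S subspace_0 by blast
  then have "(1 / norm x) *\<^sub>R x \<in> K"
    using S(1) by (auto simp: K_def subspace_scale)
  moreover have "continuous_on K (\<lambda>x. x \<bullet> (A *v x))"
    by (intro continuous_intros matrix_vector_mult_linear_continuous_on)
  ultimately obtain v where v: "v \<in> K" and max: "\<And>y. y \<in> K \<Longrightarrow> y \<bullet> (A *v y) \<le> v \<bullet> (A *v v)"
    using continuous_attains_sup[of K "\<lambda>x. x \<bullet> (A *v x)"] by blast
  define l where "l = v \<bullet> (A *v v)"
  define q where "q x = l * (x \<bullet> x) - x \<bullet> (A *v x)" for x
  have vS: "v \<in> S" and nv: "norm v = 1" using v by (auto simp: K_def)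
  have q_nonneg: "q y \<ge> 0" if "y \<in> S" for y
  proof (cases "y = 0")
    case False
    then have "(1 / norm y) *\<^sub>R y \<in> K"
      using S(1) that by (auto simp: K_def subspace_scale)
    from max[OF this] have "(y \<bullet> (A *v y)) / (norm y)\<^sup>2 \<le> l"
      by (simp add: l_def matrix_vector_mult_scaleR power2_eq_square)
    then show ?thesis
      using False by (simp add: q_def field_simps power2_norm_eq_inner)
  qed (simp add: q_def)
  have qv: "q v = 0" using nv by (simp add: q_def l_def norm_eq_1)
  have orth: "(l *\<^sub>R v - A *v v) \<bullet> y = 0" if "y \<in> S" for y
  proof (rule nonneg_quadratic_linear_coeff[where b = "q y"])
    fix t
    have "q (v + t *\<^sub>R y) = q v + 2 * t * ((l *\<^sub>R v - A *v v) \<bullet> y) + t\<^sup>2 * q y"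
      using symmetric_inner[OF sym, of v y]
      by (simp add: q_def matrix_vector_mult_scaleR matrix_vector_right_distrib
          inner_add_left inner_add_right inner_diff_left algebra_simps power2_eq_square inner_commute)
    moreover have "q (v + t *\<^sub>R y) \<ge> 0"
      using S(1) vS that by (intro q_nonneg) (auto intro: subspace_add subspace_scale)
    ultimately show "0 \<le> 2 * t * ((l *\<^sub>R v - A *v v) \<bullet> y) + t\<^sup>2 * q y"
      using qv by simp
  qed
  have "l *\<^sub>R v - A *v v \<in> S"
    using S(1) vS inv by (auto intro: subspace_diff subspace_scale)
  from orth[OF this] have "A *v v = l *\<^sub>R v" by simp
  then show ?thesis using that vS nv by blast
qed

text \<open>A largest orthonormal set of eigenvectors spans the whole space: its orthogonal complement is
  invariant under \<open>A\<close>, and a nonzero complement would contain one more eigenvector.\<close>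

lemma symmetric_orthonormal_eigenbasis:
  fixes A :: "real^'n^'n"
  assumes sym: "transpose A = A"
  obtains v :: "'n \<Rightarrow> real^'n" and l where "orthonormal_family v" "\<And>i. A *v v i = l i *\<^sub>R v i"
proof -
  define ok where "ok B \<longleftrightarrow> pairwise orthogonal B \<and>
    (\<forall>x\<in>B. norm x = 1 \<and> (\<exists>l. A *v x = l *\<^sub>R x))" for B :: "(real^'n) set"
  have indep: "independent B" if "ok B" for B
    using that by (intro pairwise_orthogonal_independent) (auto simp: ok_def)
  have fin: "finite B" and bound: "card B \<le> CARD('n)" if "ok B" for B
    using independent_bound[OF indep[OF that]] by auto
  have "ok {}" by (simp add: ok_def)
  then obtain B where B: "ok B" and max: "\<And>C. ok C \<Longrightarrow> card C \<le> card B"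
    using ex_has_greatest_nat[of ok "{}" card "Suc CARD('n)"] bound by (metis le_imp_less_Suc)
  define S where "S = {x. \<forall>b\<in>B. orthogonal b x}"
  have sub: "subspace S"
    by (auto simp: S_def subspace_def orthogonal_clauses)
  have inv: "A *v x \<in> S" if "x \<in> S" for x
    unfolding S_def
  proof (intro CollectI ballI)
    fix b assume b: "b \<in> B"
    then obtain l where "A *v b = l *\<^sub>R b" using B by (auto simp: ok_def)
    moreover have "b \<bullet> x = 0" using that b by (auto simp: S_def orthogonal_def)
    ultimately show "orthogonal b (A *v x)"
      using symmetric_inner[OF sym, of b x] by (simp add: orthogonal_def)
  qed
  have S0: "S = {0}"
  proof (rule ccontr)
    assume "S \<noteq> {0}"
    from symmetric_eigenvector_in_subspace[OF sym sub this inv]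
    obtain v l where v: "v \<in> S" "norm v = 1" "A *v v = l *\<^sub>R v" by blast
    have "v \<notin> B"
    proof
      assume "v \<in> B"
      then have "orthogonal v v" using v(1) by (auto simp: S_def)
      then show False using v(2) by (auto simp: orthogonal_def)
    qed
    moreover have "ok (insert v B)"
      using B v by (auto simp: ok_def S_def pairwise_insert orthogonal_commute)
    ultimately show False
      using max[of "insert v B"] fin[OF B] by simp
  qed
  have "x \<in> span B" for x
  proof -
    obtain y z where yz: "y \<in> span B" "\<And>w. w \<in> span B \<Longrightarrow> orthogonal z w" "x = y + z"
      using orthogonal_subspace_decomp_exists[of B x] by blast
    then have "z \<in> S" by (auto simp: S_def orthogonal_commute span_base)
    then show ?thesis using yz S0 by auto
  qed
  then have "span B = UNIV" by auto
  then have "card B = CARD('n)"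
    using dim_span[of B] indep[OF B] by (simp add: dim_eq_card_independent dim_UNIV)
  then obtain v :: "'n \<Rightarrow> real^'n" where v: "bij_betw v UNIV B"
    using fin[OF B] by (metis finite_same_card_bij finite)
  then have vB: "v i \<in> B" for i by (auto simp: bij_betw_def)
  have "v i \<bullet> v j = (if i = j then 1 else 0)" for i j
  proof (cases "i = j")
    case False
    then have "v i \<noteq> v j" using v by (auto simp: bij_betw_def inj_on_def)
    then show ?thesis using False B vB[of i] vB[of j]
      by (auto simp: ok_def pairwise_def orthogonal_def)
  qed (use B vB in \<open>auto simp: ok_def norm_eq_1\<close>)
  then have "orthonormal_family v" by (simp add: orthonormal_family_def)
  moreover have "\<forall>i. \<exists>l. A *v v i = l *\<^sub>R v i" using B vB by (auto simp: ok_def)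
  then obtain l where "\<And>i. A *v v i = l i *\<^sub>R v i" by metis
  ultimately show ?thesis using that by blast
qed

section \<open>Singular values\<close>

lemma poly_charpoly: "poly (charpoly A) x = det (mat x - A)"
  by (simp add: charpoly_def det_def poly_sum poly_prod mat_def)
     (intro sum.cong arg_cong2[where f = "(*)"] prod.cong refl; simp)

text \<open>The determinant is evaluated at each real \<open>x\<close>, where \<open>x I - A\<close> becomes diagonal in the
  eigenbasis; polynomials with equal values everywhere are equal.\<close>

lemma charpoly_orthonormal_eigenbasis:
  fixes A :: "real^'n^'n"
  assumes v: "orthonormal_family v" and l: "\<And>i. A *v v i = l i *\<^sub>R v i"
  shows "charpoly A = (\<Prod>i\<in>UNIV. [:- l i, 1:])"
proof (rule poly_eq_poly_eq_iff[THEN iffD1], rule ext)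
  fix x
  define Q :: "real^'n^'n" where "Q = (\<chi> a i. v i $ a)"
  note Q = orthonormal_family_matrix[OF v, folded Q_def]
  define D :: "real^'n^'n" where "D = (\<chi> i j. if i = j then x - l i else 0)"
  have "(mat x - A) ** Q = Q ** D"
  proof -
    have "((mat x - A) ** Q) $ a $ i = (Q ** D) $ a $ i" for a i
    proof -
      have "((mat x - A) ** Q) $ a $ i = ((mat x - A) *v v i) $ a"
        by (simp add: matrix_matrix_mult_def matrix_vector_mult_def Q_def)
      also have "(mat x - A) *v v i = (x - l i) *\<^sub>R v i"
      proof -
        have "mat x *v v i = x *\<^sub>R v i"
          by (simp add: vec_eq_iff matrix_vector_mult_def mat_def if_distrib[of "\<lambda>a. a * _"] cong: if_cong)
        then show ?thesis
          by (simp add: matrix_vector_mult_diff_rdistrib l scaleR_diff_left)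
      qed
      also have "\<dots> $ a = (Q ** D) $ a $ i"
        by (simp add: matrix_matrix_mult_def Q_def D_def if_distrib[of "\<lambda>a. _ * a"] cong: if_cong)
      finally show ?thesis .
    qed
    then show ?thesis by (simp add: vec_eq_iff)
  qed
  then have "det (mat x - A) * det Q = det D * det Q"
    by (metis det_mul mult.commute)
  moreover have "det Q \<noteq> 0"
    using Q(1) by (metis det_I det_mul mult_zero_right zero_neq_one)
  ultimately have "det (mat x - A) = det D" by simp
  also have "\<dots> = (\<Prod>i\<in>UNIV. x - l i)"
    by (subst det_diagonal) (simp_all add: D_def)
  finally show "poly (charpoly A) x = poly (\<Prod>i\<in>UNIV. [:- l i, 1:]) x"
    by (simp add: poly_charpoly poly_prod)
qed

text \<open>A singular value decomposition without its left factor: \<open>v\<close> lists right singular vectors and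
  \<open>s\<close> the singular values. The left singular vectors are the normalized \<open>X v\<^sub>i\<close> with \<open>s\<^sub>i \<noteq> 0\<close>.\<close>

definition svd :: "real^'n^'n \<Rightarrow> ('n \<Rightarrow> real^'n) \<Rightarrow> ('n \<Rightarrow> real) \<Rightarrow> bool" where
  "svd X v s \<longleftrightarrow> orthonormal_family v \<and> (\<forall>i. norm (X *v v i) = s i) \<and>
     (\<forall>i j. i \<noteq> j \<longrightarrow> (X *v v i) \<bullet> (X *v v j) = 0) \<and>
     singular_values X = image_mset s (mset_set UNIV)"

text \<open>An orthonormal eigenbasis of \<open>X\<^sup>T X\<close> diagonalizes the form \<open>(X x) \<bullet> (X y)\<close>.\<close>

lemma svd_exists:
  fixes X :: "real^'n^'n"
  obtains v s where "svd X v s"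
proof -
  define A where "A = transpose X ** X"
  have "transpose A = A" by (simp add: A_def matrix_transpose_mul)
  then obtain v :: "'n \<Rightarrow> real^'n" and l where
    v: "orthonormal_family v" and l: "\<And>i. A *v v i = l i *\<^sub>R v i"
    using symmetric_orthonormal_eigenbasis by blast
  have inner: "(X *v v i) \<bullet> (X *v v j) = (if i = j then l i else 0)" for i j
  proof -
    have "(X *v v i) \<bullet> (X *v v j) = v i \<bullet> (A *v v j)"
      by (metis A_def dot_lmul_matrix inner_commute matrix_vector_mul_assoc transpose_matrix_vector)
    then show ?thesis by (simp add: l orthonormal_family_inner[OF v])
  qed
  have l_norm: "l i = (norm (X *v v i))\<^sup>2" for i
    using inner[of i i] by (simp add: power2_norm_eq_inner)
  define s where "s i = norm (X *v v i)" for i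
  have "proots (charpoly A) = (\<Sum>i\<in>UNIV. {#l i#})"
    unfolding charpoly_orthonormal_eigenbasis[OF v l] by (subst proots_prod) auto
  also have "\<dots> = image_mset l (mset_set UNIV)"
    by (simp add: sum_unfold_sum_mset)
  finally have "singular_values X = image_mset s (mset_set UNIV)"
    by (simp add: singular_values_def A_def[symmetric] image_mset.compositionality o_def l_norm
        s_def[abs_def])
  then show ?thesis
    using v inner by (intro that[of v s]) (auto simp: svd_def s_def)
qed

lemma matrix_mult_expand:
  fixes v :: "'n \<Rightarrow> real^'n" and X :: "real^'n^'n"
  assumes "orthonormal_family v"
  shows "X *v x = (\<Sum>i\<in>UNIV. (x \<bullet> v i) *\<^sub>R (X *v v i))"
proof -
  have "X *v x = X *v (\<Sum>i\<in>UNIV. (x \<bullet> v i) *\<^sub>R v i)"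
    by (simp add: orthonormal_family_expand[OF assms])
  also have "\<dots> = (\<Sum>i\<in>UNIV. (x \<bullet> v i) *\<^sub>R (X *v v i))"
    by (simp add: linear_sum[OF matrix_vector_mul_linear] matrix_vector_mult_scaleR)
  finally show ?thesis .
qed

lemma norm_mult_orthogonal_images:
  fixes v :: "'n \<Rightarrow> real^'n" and X :: "real^'n^'n"
  assumes "orthonormal_family v" "\<And>i j. i \<noteq> j \<Longrightarrow> (X *v v i) \<bullet> (X *v v j) = 0"
  shows "(norm (X *v x))\<^sup>2 = (\<Sum>i\<in>UNIV. (x \<bullet> v i)\<^sup>2 * (norm (X *v v i))\<^sup>2)"
  unfolding matrix_mult_expand[OF assms(1), of X x]
  using assms(2)
  by (subst norm_sum_Pythagorean) (auto simp: pairwise_def orthogonal_def power_mult_distrib)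

lemma powr_le_imp_le:
  fixes x y a :: real
  assumes "x powr a \<le> y powr a" "0 \<le> x" "0 \<le> y" "0 < a"
  shows "x \<le> y"
  using powr_less_mono2[of a y x] assms by linarith

lemma
  assumes "svd X v s"
  shows svd_orthonormal: "orthonormal_family v"
    and svd_norm: "norm (X *v v i) = s i"
    and svd_orthogonal: "i \<noteq> j \<Longrightarrow> (X *v v i) \<bullet> (X *v v j) = 0"
    and svd_nonneg: "s i \<ge> 0"
  using assms norm_ge_zero[of "X *v v i"] by (auto simp: svd_def)

lemma svd_norm_mult:
  assumes "svd X v s"
  shows "(norm (X *v x))\<^sup>2 = (\<Sum>i\<in>UNIV. (x \<bullet> v i)\<^sup>2 * (s i)\<^sup>2)"
  using norm_mult_orthogonal_images[OF svd_orthonormal svd_orthogonal, OF assms assms]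
  by (simp add: svd_norm[OF assms])

lemma svd_frobenius: "svd X v s \<Longrightarrow> (norm X)\<^sup>2 = (\<Sum>i\<in>UNIV. (s i)\<^sup>2)"
  using frobenius_inner_orthonormal[OF svd_orthonormal, of X v s X X]
  by (simp add: power2_norm_eq_inner flip: svd_norm)

lemma svd_schatten_infinity: "svd X v s \<Longrightarrow> schatten_norm \<infinity> X = Max (range s)"
  by (simp add: svd_def schatten_norm_def)

lemma svd_schatten:
  "svd X v s \<Longrightarrow> schatten_norm (ereal p) X = (\<Sum>i\<in>UNIV. s i powr p) powr (1 / p)"
  by (simp add: svd_def schatten_norm_def image_mset.compositionality o_def sum_unfold_sum_mset)

lemma svd_schatten_powr:
  "svd X v s \<Longrightarrow> p \<noteq> 0 \<Longrightarrow> schatten_norm (ereal p) X powr p = (\<Sum>i\<in>UNIV. s i powr p)"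
  by (simp add: svd_schatten powr_powr sum_nonneg)

lemma svd_schatten_1:
  assumes "svd X v s"
  shows "schatten_norm 1 X = (\<Sum>i\<in>UNIV. s i)"
  using svd_schatten[OF assms, of 1]
  by (simp add: one_ereal_def sum_nonneg svd_nonneg[OF assms])

section \<open>Schatten norms, the operator norm and the Frobenius norm\<close>

lemma schatten_norm_nonneg: "1 \<le> p \<Longrightarrow> schatten_norm p X \<ge> 0"
proof (cases p rule: ereal_cases)
  case PInf
  obtain v s where X: "svd X v s" by (rule svd_exists)
  have "0 \<le> s undefined" by (rule svd_nonneg[OF X])
  also have "\<dots> \<le> schatten_norm \<infinity> X"
    unfolding svd_schatten_infinity[OF X] by (intro Max_ge) auto
  finally show ?thesis using PInf by simp
qed (auto simp: schatten_norm_def)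

text \<open>The Schatten \<open>\<infinity>\<close>-norm is the operator norm: it bounds \<open>X\<close> on every vector, and the right
  singular vector of the largest singular value attains the bound.\<close>

lemma schatten_norm_infinity_bound: "norm (X *v x) \<le> schatten_norm \<infinity> X * norm x"
proof -
  obtain v s where X: "svd X v s" by (rule svd_exists)
  have le: "s i \<le> schatten_norm \<infinity> X" for i unfolding svd_schatten_infinity[OF X] by (rule Max_ge) auto
  have "(norm (X *v x))\<^sup>2 = (\<Sum>i\<in>UNIV. (x \<bullet> v i)\<^sup>2 * (s i)\<^sup>2)"
    by (rule svd_norm_mult[OF X])
  also have "\<dots> \<le> (\<Sum>i\<in>UNIV. (x \<bullet> v i)\<^sup>2 * (schatten_norm \<infinity> X)\<^sup>2)"
    using svd_nonneg[OF X] le by (intro sum_mono mult_left_mono power_mono) auto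
  also have "\<dots> = (schatten_norm \<infinity> X * norm x)\<^sup>2"
    by (simp add: parseval_norm[OF svd_orthonormal[OF X]] power_mult_distrib flip: sum_distrib_right)
  finally show ?thesis
    by (rule power2_le_imp_le) (simp add: schatten_norm_nonneg)
qed

lemma schatten_norm_infinity_attained:
  obtains x where "norm x = 1" "norm (X *v x) = schatten_norm \<infinity> X"
proof -
  obtain v s where X: "svd X v s" by (rule svd_exists)
  have "Max (range s) \<in> range s" by (intro Max_in) auto
  then obtain i where "schatten_norm \<infinity> X = s i" unfolding svd_schatten_infinity[OF X] by blast
  then show ?thesis using that[of "v i"] svd_norm[OF X] orthonormal_family_norm[OF svd_orthonormal[OF X]]
    by simp
qed

lemma bilinear_le_schatten_norm_infinity:
  "x \<bullet> (X *v y) \<le> schatten_norm \<infinity> X * norm x * norm y"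
proof -
  have "x \<bullet> (X *v y) \<le> norm x * norm (X *v y)" by (rule norm_cauchy_schwarz)
  also have "\<dots> \<le> norm x * (schatten_norm \<infinity> X * norm y)"
    by (intro mult_left_mono schatten_norm_infinity_bound) auto
  finally show ?thesis by (simp add: mult_ac)
qed

lemma schatten_norm_infinity_le:
  assumes "1 \<le> p"
  shows "schatten_norm \<infinity> X \<le> schatten_norm p X"
proof (cases p rule: ereal_cases)
  case (real r)
  with assms have r: "r \<ge> 1" by simp
  obtain v s where X: "svd X v s" by (rule svd_exists)
  have "s i \<le> schatten_norm p X" for i
  proof -
    have "s i = (s i powr r) powr (1 / r)" using svd_nonneg[OF X] r by (simp add: powr_powr)
    also have "\<dots> \<le> (\<Sum>i\<in>UNIV. s i powr r) powr (1 / r)"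
      using r by (intro powr_mono2 member_le_sum) auto
    finally show ?thesis by (simp add: svd_schatten[OF X] real)
  qed
  then show ?thesis unfolding svd_schatten_infinity[OF X] by (subst Max_le_iff) auto
qed (use assms in auto)

lemma schatten_norm_2: "schatten_norm 2 X = norm X"
proof -
  obtain v s where X: "svd X v s" by (rule svd_exists)
  have "schatten_norm (ereal 2) X = sqrt ((norm X)\<^sup>2)"
    unfolding svd_schatten[OF X] svd_frobenius[OF X]
    by (subst powr_half_sqrt[symmetric]) (auto simp: sum_nonneg svd_nonneg[OF X])
  then show ?thesis by simp
qed

text \<open>Interpolation between the operator norm \<open>M\<close> and the Frobenius norm: each \<open>s\<^sup>p\<close> is at most
  \<open>M\<^bsup>p-2\<^esup> s\<^sup>2\<close>. Keeping \<open>M\<close> in the bound, rather than replacing it by the Frobenius norm, yields the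
  equality case for \<open>p > 2\<close> below.\<close>

lemma schatten_norm_powr_le:
  assumes "2 \<le> p"
  shows "schatten_norm (ereal p) X powr p \<le> schatten_norm \<infinity> X powr (p - 2) * (norm X)\<^sup>2"
proof -
  obtain v s where X: "svd X v s" by (rule svd_exists)
  have "schatten_norm (ereal p) X powr p = (\<Sum>i\<in>UNIV. s i powr p)"
    using assms by (simp add: svd_schatten_powr[OF X])
  also have "\<dots> \<le> (\<Sum>i\<in>UNIV. schatten_norm \<infinity> X powr (p - 2) * (s i)\<^sup>2)"
  proof (rule sum_mono)
    fix i
    have "s i powr p = s i powr (p - 2) * (s i)\<^sup>2"
      using svd_nonneg[OF X, of i] by (cases "s i = 0") (auto simp: powr_diff)
    also have "\<dots> \<le> schatten_norm \<infinity> X powr (p - 2) * (s i)\<^sup>2"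
      using assms svd_nonneg[OF X] unfolding svd_schatten_infinity[OF X] by (intro mult_right_mono powr_mono2 Max_ge) auto
    finally show "s i powr p \<le> schatten_norm \<infinity> X powr (p - 2) * (s i)\<^sup>2" .
  qed
  also have "\<dots> = schatten_norm \<infinity> X powr (p - 2) * (norm X)\<^sup>2"
    by (simp add: svd_frobenius[OF X] sum_distrib_left)
  finally show ?thesis .
qed

lemma schatten_norm_le_frobenius:
  assumes "2 \<le> p"
  shows "schatten_norm p X \<le> norm X"
proof -
  have inf: "schatten_norm \<infinity> X \<le> norm X"
    using schatten_norm_infinity_le[of 2 X] unfolding schatten_norm_2 by simp
  show ?thesis
  proof (cases p rule: ereal_cases)
    case (real r)
    with assms have r: "r \<ge> 2" by simp
    have "schatten_norm (ereal r) X powr r \<le> schatten_norm \<infinity> X powr (r - 2) * (norm X)\<^sup>2"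
      using r by (rule schatten_norm_powr_le)
    also have "\<dots> \<le> norm X powr (r - 2) * (norm X)\<^sup>2"
      using r inf by (intro mult_right_mono powr_mono2) (auto simp: schatten_norm_nonneg)
    also have "\<dots> = norm X powr r"
      by (cases "X = 0") (auto simp: powr_diff)
    finally have "schatten_norm (ereal r) X \<le> norm X"
      by (rule powr_le_imp_le) (use r in \<open>simp_all add: schatten_norm_nonneg\<close>)
    then show ?thesis using real by simp
  qed (use assms inf in auto)
qed

text \<open>If \<open>F\<close> is the Frobenius norm and \<open>M\<close> the operator norm, interpolation gives
  \<open>F\<^sup>p \<le> M\<^bsup>p-2\<^esup> F\<^sup>2\<close>, hence \<open>F \<le> M\<close>: all singular values but the largest vanish.\<close>

lemma schatten_norm_eq_frobenius_imp:
  assumes "2 < p" "schatten_norm p X = norm X"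
  shows "schatten_norm \<infinity> X = norm X"
proof (cases p rule: ereal_cases)
  case (real r)
  with assms have r: "r > 2" by simp
  have "norm X \<le> schatten_norm \<infinity> X"
  proof (cases "X = 0")
    case False
    have "norm X powr (r - 2) * (norm X)\<^sup>2 = norm X powr r"
      using False by (auto simp: powr_diff)
    also have "\<dots> \<le> schatten_norm \<infinity> X powr (r - 2) * (norm X)\<^sup>2"
      using schatten_norm_powr_le[of r X] r assms(2) real by simp
    finally have "norm X powr (r - 2) \<le> schatten_norm \<infinity> X powr (r - 2)"
      using False by simp
    then show ?thesis
      by (rule powr_le_imp_le) (use r in \<open>simp_all add: schatten_norm_nonneg\<close>)
  qed (simp add: schatten_norm_nonneg)
  then show ?thesis
    using schatten_norm_le_frobenius[of \<infinity> X] by simp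
qed (use assms in auto)

text \<open>A sum of nonnegative powers that does not exceed its largest term has no other nonzero term, so
  there is at most one nonzero singular value.\<close>

lemma schatten_norm_le_infinity_imp:
  assumes "1 \<le> p" "schatten_norm (ereal p) X \<le> schatten_norm \<infinity> X"
  shows "norm X = schatten_norm \<infinity> X"
proof -
  obtain v s where X: "svd X v s" by (rule svd_exists)
  have "Max (range s) \<in> range s" by (intro Max_in) auto
  then obtain i where i: "schatten_norm \<infinity> X = s i" unfolding svd_schatten_infinity[OF X] by blast
  have "(\<Sum>j\<in>UNIV. s j powr p) = schatten_norm (ereal p) X powr p"
    using assms by (simp add: svd_schatten_powr[OF X])
  also have "\<dots> \<le> s i powr p"
    using assms i by (intro powr_mono2) (auto simp: schatten_norm_nonneg)
  finally have "(\<Sum>j\<in>UNIV - {i}. s j powr p) \<le> 0"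
    by (simp add: sum.remove[of UNIV i])
  then have "(\<Sum>j\<in>UNIV - {i}. s j powr p) = 0"
    by (intro antisym sum_nonneg) auto
  then have "\<forall>j\<in>UNIV - {i}. s j powr p = 0"
    by (subst (asm) sum_nonneg_eq_0_iff) auto
  then have "(\<Sum>j\<in>UNIV - {i}. (s j)\<^sup>2) = 0" by simp
  then have "(norm X)\<^sup>2 = (s i)\<^sup>2"
    by (simp add: svd_frobenius[OF X] sum.remove[of UNIV i])
  then show ?thesis using i svd_nonneg[OF X] by (simp add: power2_eq_iff_nonneg)
qed

lemma inner_outer:
  fixes A :: "real^'n^'m"
  shows "A \<bullet> outer y x = (A *v x) \<bullet> y"
  by (simp add: inner_vec_def outer_def matrix_vector_mult_def sum_distrib_right
      sum_distrib_left mult_ac)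

lemma outer_mult: "outer y x *v z = (x \<bullet> z) *\<^sub>R (y :: real^'m)"
  by (simp add: vec_eq_iff outer_def matrix_vector_mult_def inner_vec_def
      sum_distrib_left sum_distrib_right mult_ac)

text \<open>The matrix \<open>X - (X x) x\<^sup>T\<close> is orthogonal to \<open>(X x) x\<^sup>T\<close>, so the square of its Frobenius norm is
  the difference of the squares of the norms of \<open>X\<close> and of \<open>X x\<close>.\<close>

lemma rank_one_if_frobenius_attained:
  fixes X :: "real^'n^'n"
  assumes "norm x = 1" "norm (X *v x) = norm X"
  shows "X = outer (X *v x) x"
proof -
  let ?R = "outer (X *v x) x"
  have "?R *v x = X *v x"
    using assms(1) by (simp add: outer_mult norm_eq_1)
  then have "?R \<bullet> ?R = (X *v x) \<bullet> (X *v x)" "X \<bullet> ?R = (X *v x) \<bullet> (X *v x)"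
    by (simp_all add: inner_outer)
  then have "(X - ?R) \<bullet> (X - ?R) = X \<bullet> X - (X *v x) \<bullet> (X *v x)"
    by (simp add: inner_diff_left inner_diff_right inner_commute)
  also have "\<dots> = 0"
    using assms(2) by (simp flip: power2_norm_eq_inner)
  finally show ?thesis by simp
qed

text \<open>If the largest singular value is at least \<open>1\<close>, the squares of the others add up to at most the
  excess of the squared Frobenius norm over \<open>1\<close>. Near the uniform matrix that excess is of order
  \<open>t\<^sup>2\<close>, so the second summand is of order \<open>t\<^sup>p\<close>, which is negligible against \<open>t\<close> when \<open>p > 1\<close>.\<close>

lemma schatten_norm_powr_le_excess:
  fixes X :: "real^'n^'n"
  assumes "0 < p" "1 \<le> schatten_norm \<infinity> X"
  shows "schatten_norm (ereal p) X powr p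
    \<le> ((norm X)\<^sup>2) powr (p / 2) + real CARD('n) * ((norm X)\<^sup>2 - 1) powr (p / 2)"
proof -
  obtain v s where X: "svd X v s" by (rule svd_exists)
  have sq: "s i powr p = ((s i)\<^sup>2) powr (p / 2)" for i
    using svd_nonneg[OF X, of i] by (simp add: powr_powr flip: powr_numeral)
  have "Max (range s) \<in> range s" by (intro Max_in) auto
  then obtain i where i: "s i \<ge> 1"
    using assms(2) unfolding svd_schatten_infinity[OF X] by (metis imageE)
  have F: "(norm X)\<^sup>2 = (s i)\<^sup>2 + (\<Sum>j\<in>UNIV - {i}. (s j)\<^sup>2)"
    by (simp add: svd_frobenius[OF X] sum.remove[of UNIV i])
  have top: "s i powr p \<le> ((norm X)\<^sup>2) powr (p / 2)"
    unfolding sq F using assms(1) by (intro powr_mono2) (auto simp: sum_nonneg)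
  have "s j powr p \<le> ((norm X)\<^sup>2 - 1) powr (p / 2)" if "j \<noteq> i" for j
  proof -
    have "(s j)\<^sup>2 \<le> (\<Sum>j\<in>UNIV - {i}. (s j)\<^sup>2)"
      using that by (intro member_le_sum) auto
    moreover have "(s i)\<^sup>2 \<ge> 1" using i by simp
    ultimately have "(s j)\<^sup>2 \<le> (norm X)\<^sup>2 - 1" using F by linarith
    then show ?thesis unfolding sq using assms(1) by (intro powr_mono2) auto
  qed
  then have "(\<Sum>j\<in>UNIV - {i}. s j powr p) \<le> real (card (UNIV - {i})) * ((norm X)\<^sup>2 - 1) powr (p / 2)"
    by (intro sum_bounded_above) auto
  also have "\<dots> \<le> real CARD('n) * ((norm X)\<^sup>2 - 1) powr (p / 2)"
    by (intro mult_right_mono) (auto intro: card_mono)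
  finally show ?thesis
    using top assms(1) by (simp add: svd_schatten_powr[OF X] sum.remove[of UNIV i])
qed

section \<open>Tangent bounds for the powers of the singular values\<close>

text \<open>Concavity of \<open>y\<^sup>a\<close> at \<open>y = 1\<close>, as a weighted arithmetic-geometric mean inequality. With \<open>m\<close> the
  value of the tangent line, the inequality \<open>ln z \<le> z - 1\<close> is used at \<open>z = y / m\<close> with weight \<open>a\<close>
  and at \<open>z = 1 / m\<close> with weight \<open>1 - a\<close>; the right-hand sides cancel. It is strict at \<open>1 / m\<close>
  unless \<open>m = 1\<close>, which settles equality.\<close>

lemma powr_le_tangent:
  fixes a y :: real
  assumes "0 < a" "a < 1" "0 \<le> y"
  shows "y powr a \<le> 1 + a * (y - 1)" "y powr a = 1 + a * (y - 1) \<Longrightarrow> y = 1"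
proof -
  have *: "y powr a < 1 + a * (y - 1)" if "y \<noteq> 1"
  proof (cases "y = 0")
    case False
    with assms have y: "y > 0" by simp
    define m where "m = 1 + a * (y - 1)"
    have "m = (1 - a) + a * y" by (simp add: m_def algebra_simps)
    then have m: "m > 0" using assms y by (auto intro: add_pos_pos)
    have "m \<noteq> 1" using assms that by (simp add: m_def)
    have "ln (1 / m) < 1 / m - 1"
      using m \<open>m \<noteq> 1\<close> ln_le_minus_one[of "1 / m"] ln_eq_minus_one[of "1 / m"] by fastforce
    then have "(1 - a) * ln (1 / m) < (1 - a) * (1 / m - 1)"
      using assms by simp
    moreover have "a * ln (y / m) \<le> a * (y / m - 1)"
      using assms y m by (intro mult_left_mono ln_le_minus_one) auto
    moreover have "(1 - a) * (1 / m - 1) + a * (y / m - 1) = 0"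
    proof -
      have "(1 - a) * (1 / m - 1) + a * (y / m - 1) = ((1 - a) + a * y) / m - 1"
        using m by (simp add: field_simps)
      then show ?thesis using m \<open>m = (1 - a) + a * y\<close> by simp
    qed
    ultimately have "a * ln y < ln m"
      using y m by (simp add: ln_div algebra_simps)
    then have "exp (a * ln y) < m"
      using m by (metis exp_less_mono exp_ln)
    then show ?thesis using y by (simp add: powr_def m_def)
  qed (use assms in auto)
  show "y powr a \<le> 1 + a * (y - 1)" using * assms by (cases "y = 1") auto
  show "y = 1" if "y powr a = 1 + a * (y - 1)" using * that by force
qed

text \<open>The tangent bound for the exponent \<open>1 / p\<close>, read at \<open>y\<^sup>p\<close>.\<close>

lemma bernoulli_powr:
  fixes p y :: real
  assumes "1 \<le> p" "0 \<le> y"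
  shows "1 + p * (y - 1) \<le> y powr p"
proof (cases "p = 1")
  case False
  with assms have p: "p > 1" by simp
  have "(y powr p) powr (1 / p) \<le> 1 + (1 / p) * (y powr p - 1)"
    using p by (intro powr_le_tangent) auto
  then have "y \<le> 1 + (1 / p) * (y powr p - 1)"
    using p assms by (simp add: powr_powr)
  then show ?thesis using p by (simp add: field_simps)
qed (use assms in simp)

text \<open>Bernoulli's inequality summed over the singular values. This bound and the upper bound that
  follows have the same first-order behaviour where all singular values are \<open>1\<close>, that is, at
  orthogonal matrices.\<close>

lemma schatten_norm_powr_lower:
  fixes X :: "real^'n^'n"
  assumes "1 \<le> p"
  shows "real CARD('n) + p * (schatten_norm 1 X - real CARD('n)) \<le> schatten_norm (ereal p) X powr p"
proof -
  obtain v s where X: "svd X v s" by (rule svd_exists)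
  have "real CARD('n) + p * (schatten_norm 1 X - real CARD('n))
      = (\<Sum>i\<in>UNIV. 1 + p * (s i - 1))"
    by (simp add: sum.distrib sum_subtractf svd_schatten_1[OF X] flip: sum_distrib_left)
  also have "\<dots> \<le> (\<Sum>i\<in>UNIV. s i powr p)"
    using assms svd_nonneg[OF X] by (intro sum_mono bernoulli_powr) auto
  finally show ?thesis using svd_schatten_powr[OF X] assms by simp
qed

text \<open>The tangent bound for the exponent \<open>p / 2\<close>, applied to the squares of the singular values and
  summed. Equality makes every singular value \<open>1\<close>, so \<open>X\<close> preserves norms.\<close>

lemma schatten_norm_powr_upper:
  fixes X :: "real^'n^'n"
  assumes "1 \<le> p" "p < 2"
  shows "schatten_norm (ereal p) X powr p \<le> real CARD('n) + p / 2 * ((norm X)\<^sup>2 - real CARD('n))"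
    and "schatten_norm (ereal p) X powr p = real CARD('n) + p / 2 * ((norm X)\<^sup>2 - real CARD('n))
      \<Longrightarrow> transpose X ** X = mat 1"
proof -
  obtain v s where X: "svd X v s" by (rule svd_exists)
  have sq: "s i powr p = ((s i)\<^sup>2) powr (p / 2)" for i
    using svd_nonneg[OF X, of i] by (simp add: powr_powr flip: powr_numeral)
  have le: "s i powr p \<le> 1 + p / 2 * ((s i)\<^sup>2 - 1)" for i
    unfolding sq using assms by (intro powr_le_tangent) auto
  have R: "real CARD('n) + p / 2 * ((norm X)\<^sup>2 - real CARD('n))
      = (\<Sum>i\<in>UNIV. 1 + p / 2 * ((s i)\<^sup>2 - 1))"
    by (simp add: sum.distrib sum_subtractf svd_frobenius[OF X] del: times_divide_eq_left
        flip: sum_distrib_left)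
  have L: "schatten_norm (ereal p) X powr p = (\<Sum>i\<in>UNIV. s i powr p)"
    using svd_schatten_powr[OF X] assms by simp
  show "schatten_norm (ereal p) X powr p \<le> real CARD('n) + p / 2 * ((norm X)\<^sup>2 - real CARD('n))"
    unfolding L R by (intro sum_mono le)
  assume "schatten_norm (ereal p) X powr p = real CARD('n) + p / 2 * ((norm X)\<^sup>2 - real CARD('n))"
  then have "s i powr p = 1 + p / 2 * ((s i)\<^sup>2 - 1)" for i
    unfolding L R using sum_mono_inv[of "\<lambda>i. s i powr p" UNIV "\<lambda>i. 1 + p / 2 * ((s i)\<^sup>2 - 1)" i] le
    by simp
  then have sq1: "(s i)\<^sup>2 = 1" for i
    unfolding sq using assms by (intro powr_le_tangent(2)[of "p / 2"]) auto
  have "norm (X *v x) = norm x" for x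
    using svd_norm_mult[OF X, of x] sq1 parseval_norm[OF svd_orthonormal[OF X], of x]
    by (simp add: power2_eq_iff_nonneg)
  then have "orthogonal_transformation ((*v) X)"
    by (simp add: orthogonal_transformation)
  then show "transpose X ** X = mat 1"
    by (simp add: orthogonal_transformation_matrix orthogonal_matrix)
qed

lemma schatten_norm_orthogonal:
  fixes X :: "real^'n^'n"
  assumes "transpose X ** X = mat 1" "p \<noteq> 0"
  shows "schatten_norm (ereal p) X = real CARD('n) powr (1 / p)"
proof -
  obtain v s where X: "svd X v s" by (rule svd_exists)
  have "orthogonal_transformation ((*v) X)"
    using assms(1) by (simp add: orthogonal_transformation_matrix orthogonal_matrix)
  then have "s i = 1" for i
    using svd_norm[OF X] orthonormal_family_norm[OF svd_orthonormal[OF X]]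
    by (metis orthogonal_transformation)
  then show ?thesis by (simp add: svd_schatten[OF X])
qed

section \<open>The trace norm and duality\<close>

text \<open>The trace norm is dual to the operator norm: Cauchy-Schwarz is applied to each term of \<open>W \<bullet> X\<close>
  expanded in right singular vectors of \<open>X\<close>.\<close>

lemma contraction_inner_le_schatten_norm_1:
  assumes "\<And>x. norm (W *v x) \<le> norm x"
  shows "W \<bullet> X \<le> schatten_norm 1 X"
proof -
  obtain v s where X: "svd X v s" by (rule svd_exists)
  have "W \<bullet> X = (\<Sum>i\<in>UNIV. (W *v v i) \<bullet> (X *v v i))"
    by (rule frobenius_inner_orthonormal[OF svd_orthonormal[OF X], symmetric])
  also have "\<dots> \<le> (\<Sum>i\<in>UNIV. s i)"
  proof (rule sum_mono)
    fix i
    have "(W *v v i) \<bullet> (X *v v i) \<le> norm (W *v v i) * norm (X *v v i)"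
      by (rule norm_cauchy_schwarz)
    also have "\<dots> \<le> 1 * s i"
      using assms[of "v i"] svd_norm[OF X, of i] svd_nonneg[OF X, of i]
        orthonormal_family_norm[OF svd_orthonormal[OF X], of i]
      by (intro mult_mono) auto
    finally show "(W *v v i) \<bullet> (X *v v i) \<le> s i" by simp
  qed
  finally show ?thesis by (simp add: svd_schatten_1[OF X])
qed

text \<open>The dual bound is attained by the partial isometry of the polar decomposition, which sends
  \<open>v\<^sub>j\<close> to the left singular vector \<open>X v\<^sub>j / s\<^sub>j\<close>. Where \<open>s\<^sub>j = 0\<close> the convention \<open>1 / 0 = 0\<close>
  makes it vanish, as it should.\<close>

lemma schatten_norm_1_attained:
  fixes X :: "real^'n^'n"
  obtains W :: "real^'n^'n" where "\<And>x. norm (W *v x) \<le> norm x" "W \<bullet> X = schatten_norm 1 X"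
proof -
  obtain v s where X: "svd X v s" by (rule svd_exists)
  define W where "W = (\<Sum>j\<in>UNIV. outer ((1 / s j) *\<^sub>R (X *v v j)) (v j))"
  have W: "W *v v i = (1 / s i) *\<^sub>R (X *v v i)" for i
  proof -
    have "W *v v i = (\<Sum>j\<in>UNIV. (v j \<bullet> v i) *\<^sub>R ((1 / s j) *\<^sub>R (X *v v j)))"
      unfolding W_def by (induction rule: infinite_finite_induct)
        (simp_all add: matrix_vector_mult_add_rdistrib outer_mult)
    also have "\<dots> = (\<Sum>j\<in>UNIV. if j = i then (1 / s j) *\<^sub>R (X *v v j) else 0)"
      by (intro sum.cong refl) (simp add: orthonormal_family_inner[OF svd_orthonormal[OF X]])
    finally show ?thesis by simp
  qed
  have nW: "norm (W *v v i) \<le> 1" for i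
    using svd_nonneg[OF X, of i] by (simp add: W svd_norm[OF X])
  have "norm (W *v x) \<le> norm x" for x
  proof (rule power2_le_imp_le)
    have "(norm (W *v x))\<^sup>2 = (\<Sum>i\<in>UNIV. (x \<bullet> v i)\<^sup>2 * (norm (W *v v i))\<^sup>2)"
      using svd_orthogonal[OF X]
      by (intro norm_mult_orthogonal_images svd_orthonormal[OF X]) (auto simp: W)
    also have "\<dots> \<le> (\<Sum>i\<in>UNIV. (x \<bullet> v i)\<^sup>2 * 1)"
      using nW by (intro sum_mono mult_left_mono) (auto simp: power_le_one)
    finally show "(norm (W *v x))\<^sup>2 \<le> (norm x)\<^sup>2"
      by (simp add: parseval_norm[OF svd_orthonormal[OF X]])
  qed simp
  moreover have "W \<bullet> X = schatten_norm 1 X"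
  proof -
    have "W \<bullet> X = (\<Sum>i\<in>UNIV. (W *v v i) \<bullet> (X *v v i))"
      by (rule frobenius_inner_orthonormal[OF svd_orthonormal[OF X], symmetric])
    also have "\<dots> = (\<Sum>i\<in>UNIV. s i)"
      by (intro sum.cong refl) (simp add: W svd_norm[OF X] power2_eq_square flip: power2_norm_eq_inner)
    finally show ?thesis by (simp add: svd_schatten_1[OF X])
  qed
  ultimately show ?thesis using that by blast
qed

text \<open>A maximum of linear functionals.\<close>

lemma convex_schatten_norm_1: "convex_on UNIV (schatten_norm 1)"
proof (rule convex_onI)
  fix t :: real and X Y :: "real^'n^'n"
  assume t: "0 < t" "t < 1"
  obtain W :: "real^'n^'n" where W: "\<And>x. norm (W *v x) \<le> norm x"
    "W \<bullet> ((1 - t) *\<^sub>R X + t *\<^sub>R Y) = schatten_norm 1 ((1 - t) *\<^sub>R X + t *\<^sub>R Y)"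
    using schatten_norm_1_attained by blast
  then have "schatten_norm 1 ((1 - t) *\<^sub>R X + t *\<^sub>R Y) = (1 - t) * (W \<bullet> X) + t * (W \<bullet> Y)"
    by (metis inner_add_right inner_scaleR_right)
  also have "\<dots> \<le> (1 - t) * schatten_norm 1 X + t * schatten_norm 1 Y"
    using t W(1) by (intro add_mono mult_left_mono contraction_inner_le_schatten_norm_1) auto
  finally show "schatten_norm 1 ((1 - t) *\<^sub>R X + t *\<^sub>R Y) \<le> (1 - t) * schatten_norm 1 X + t * schatten_norm 1 Y" .
qed simp

text \<open>A maximum of the convex functions \<open>norm (X x)\<close> over unit vectors \<open>x\<close>.\<close>

lemma convex_schatten_norm_infinity: "convex_on UNIV (schatten_norm \<infinity>)"
proof (rule convex_onI)
  fix t :: real and X Y :: "real^'n^'n"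
  assume t: "0 < t" "t < 1"
  obtain x where x: "norm x = 1"
    "norm (((1 - t) *\<^sub>R X + t *\<^sub>R Y) *v x) = schatten_norm \<infinity> ((1 - t) *\<^sub>R X + t *\<^sub>R Y)"
    using schatten_norm_infinity_attained by blast
  have "schatten_norm \<infinity> ((1 - t) *\<^sub>R X + t *\<^sub>R Y) = norm ((1 - t) *\<^sub>R (X *v x) + t *\<^sub>R (Y *v x))"
    by (simp add: matrix_vector_mult_add_rdistrib scaleR_matrix_vector_assoc flip: x(2))
  also have "\<dots> \<le> (1 - t) * norm (X *v x) + t * norm (Y *v x)"
    using t by (intro norm_triangle_le) simp
  also have "\<dots> \<le> (1 - t) * schatten_norm \<infinity> X + t * schatten_norm \<infinity> Y"
    using t schatten_norm_infinity_bound[of X x] schatten_norm_infinity_bound[of Y x] x(1)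
    by (intro add_mono mult_left_mono) auto
  finally show "schatten_norm \<infinity> ((1 - t) *\<^sub>R X + t *\<^sub>R Y) \<le> (1 - t) * schatten_norm \<infinity> X + t * schatten_norm \<infinity> Y" .
qed simp

section \<open>Directional derivatives\<close>

lemma gateaux_derivativeI:
  assumes "((\<lambda>t. (\<phi> (x + t *\<^sub>R u) - \<phi> x) / t) \<longlongrightarrow> L) (at_right 0)"
  shows "gateaux_derivative \<phi> x u = L"
  unfolding gateaux_derivative_def using assms by (intro tendsto_Lim) auto

lemma gateaux_derivative_zero: "gateaux_derivative \<phi> x 0 = 0"
  by (rule gateaux_derivativeI) simp

text \<open>Two bounds that touch \<open>\<phi>\<close> at \<open>x\<close> with the same slope determine the derivative. This takes the
  place of perturbation theory for singular values: explicit bounds are chosen for each exponent.\<close>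

lemma gateaux_derivative_squeeze:
  assumes "\<And>t. t > 0 \<Longrightarrow> t < e \<Longrightarrow> l t \<le> \<phi> (x + t *\<^sub>R u)" "e > 0"
    "\<And>t. t > 0 \<Longrightarrow> \<phi> (x + t *\<^sub>R u) \<le> h t"
    "((\<lambda>t. (l t - \<phi> x) / t) \<longlongrightarrow> L) (at_right 0)"
    "((\<lambda>t. (h t - \<phi> x) / t) \<longlongrightarrow> L) (at_right 0)"
  shows "gateaux_derivative \<phi> x u = L"
proof (rule gateaux_derivativeI, rule tendsto_sandwich[OF _ _ assms(4,5)])
  show "\<forall>\<^sub>F t in at_right 0. (l t - \<phi> x) / t \<le> (\<phi> (x + t *\<^sub>R u) - \<phi> x) / t"
    using assms(1,2) by (intro eventually_at_rightI[of 0 e] divide_right_mono diff_right_mono) auto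
  show "\<forall>\<^sub>F t in at_right 0. (\<phi> (x + t *\<^sub>R u) - \<phi> x) / t \<le> (h t - \<phi> x) / t"
    using assms(3) by (intro eventually_at_rightI[of 0 1] divide_right_mono diff_right_mono) auto
qed

text \<open>The value of \<open>gateaux_derivative\<close> is meaningful only if the limit exists. For a convex function
  the difference quotient decreases as \<open>t\<close> decreases to \<open>0\<close>, so a lower bound makes it converge to
  its infimum.\<close>

lemma convex_gateaux_derivative_ge:
  assumes conv: "convex_on UNIV \<phi>" and lower: "\<And>t. t > 0 \<Longrightarrow> t < e \<Longrightarrow> \<phi> x + c * t \<le> \<phi> (x + t *\<^sub>R u)" "e > 0"
  shows "c \<le> gateaux_derivative \<phi> x u"
proof -
  define q where "q t = (\<phi> (x + t *\<^sub>R u) - \<phi> x) / t" for t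
  have mono: "q s \<le> q t" if "0 < s" "s \<le> t" for s t
  proof -
    have "x + s *\<^sub>R u = (1 - s / t) *\<^sub>R x + (s / t) *\<^sub>R (x + t *\<^sub>R u)"
      using that by (simp add: algebra_simps)
    then have "\<phi> (x + s *\<^sub>R u) \<le> (1 - s / t) * \<phi> x + (s / t) * \<phi> (x + t *\<^sub>R u)"
      using that convex_onD[OF conv, of "s / t" x "x + t *\<^sub>R u"] by simp
    then have "\<phi> (x + s *\<^sub>R u) - \<phi> x \<le> s * q t"
      by (simp add: q_def algebra_simps diff_divide_distrib)
    then show ?thesis using that by (simp add: q_def[of s] field_simps)
  qed
  have c_small: "c \<le> q t" if "0 < t" "t < e" for t
    using lower(1)[OF that] that by (simp add: q_def field_simps)
  have c: "c \<le> q t" if "0 < t" for t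
    using order.trans[OF c_small[of "min t (e / 2)"] mono[of "min t (e / 2)" t]] that lower(2)
    by (simp add: min_def split: if_splits)
  then have bdd: "bdd_below (q ` {0<..})" by (auto intro!: bdd_belowI[of _ c])
  define L where "L = Inf (q ` {0<..})"
  have "(q \<longlongrightarrow> L) (at_right 0)"
  proof (rule order_tendstoI)
    fix a assume "a < L"
    moreover have "L \<le> q t" if "t > 0" for t
      unfolding L_def using that bdd by (intro cInf_lower) auto
    ultimately show "\<forall>\<^sub>F t in at_right 0. a < q t"
      by (intro eventually_at_rightI[of 0 1]) (auto intro: less_le_trans)
  next
    fix a assume "L < a"
    then obtain t where t: "t > 0" "q t < a"
      unfolding L_def using cInf_lessD[of "q ` {0<..}" a] by auto
    show "\<forall>\<^sub>F s in at_right 0. q s < a"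
      using t(1) by (intro eventually_at_rightI[of 0 t] le_less_trans[OF mono t(2)]) auto
  qed
  then have "gateaux_derivative \<phi> x u = L"
    unfolding q_def by (rule gateaux_derivativeI)
  moreover have "c \<le> L"
    unfolding L_def using c by (intro cInf_greatest) auto
  ultimately show ?thesis by simp
qed

lemma norm_gateaux_derivative_tendsto:
  fixes X B :: "'a::real_inner"
  assumes "X \<noteq> 0"
  shows "((\<lambda>t. (norm (X + t *\<^sub>R B) - norm X) / t) \<longlongrightarrow> (X \<bullet> B) / norm X) (at_right 0)"
proof -
  have eq: "norm (X + t *\<^sub>R B) = sqrt ((norm X)\<^sup>2 + 2 * t * (X \<bullet> B) + t\<^sup>2 * (norm B)\<^sup>2)" for t
    by (simp add: norm_eq_sqrt_inner inner_add_left inner_add_right inner_commute algebra_simps power2_eq_square)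
  have n: "norm X > 0" using assms by simp
  have "((\<lambda>t. (sqrt (a\<^sup>2 + 2 * t * c + t\<^sup>2 * b) - a) / t) \<longlongrightarrow> c / a) (at_right 0)"
    if "a > 0" for a b c :: real
  proof -
    have "\<bar>a\<bar> * (inverse (a\<^sup>2) * c) = c / a" using that by (simp add: field_simps power2_eq_square)
    then show ?thesis using that by real_asymp
  qed
  from this[OF n] show ?thesis by (simp add: eq)
qed

lemma powr_root_slope:
  fixes a c b p :: real
  assumes "a > 0" "p > 0"
  shows "((\<lambda>t. ((a + p * t * c + t\<^sup>2 * b) powr (1 / p) - a powr (1 / p)) / t) \<longlongrightarrow> a powr (1 / p - 1) * c) (at_right 0)"
proof -
  have "a powr (1 / p) * (inverse a * c) = a powr (1 / p - 1) * c"
    using assms by (simp add: powr_diff divide_inverse)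
  then show ?thesis using assms by real_asymp
qed

lemma powr_perturbation_slope:
  fixes c b p :: real
  assumes "p > 1" "b > 0"
  shows "((\<lambda>t. ((1 + t\<^sup>2 * b) powr (p / 2) + c * t powr p - 1) / t) \<longlongrightarrow> 0) (at_right 0)"
proof -
  have "((\<lambda>t. ((1 + t\<^sup>2 * b) powr (p / 2) - 1) / t) \<longlongrightarrow> 0) (at_right 0)"
    using assms by real_asymp
  moreover have "((\<lambda>t::real. t powr (p - 1)) \<longlongrightarrow> 0) (at_right 0)"
    using assms by real_asymp
  then have "((\<lambda>t. c * t powr (p - 1)) \<longlongrightarrow> 0) (at_right 0)"
    by (rule tendsto_mult_right_zero)
  ultimately have "((\<lambda>t. ((1 + t\<^sup>2 * b) powr (p / 2) - 1) / t + c * t powr (p - 1)) \<longlongrightarrow> 0 + 0) (at_right 0)"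
    by (rule tendsto_add)
  moreover have "\<forall>\<^sub>F t in at_right 0. ((1 + t\<^sup>2 * b) powr (p / 2) - 1) / t + c * t powr (p - 1)
      = ((1 + t\<^sup>2 * b) powr (p / 2) + c * t powr p - 1) / t"
    by (intro eventually_at_rightI[of 0 1]) (auto simp: powr_diff add_divide_distrib diff_divide_distrib)
  ultimately show ?thesis
    by (simp add: tendsto_cong)
qed

section \<open>Column-stochastic matrices\<close>

definition col_stochastic :: "real^'n^'n \<Rightarrow> bool" where
  "col_stochastic S \<longleftrightarrow> (\<forall>i j. 0 \<le> S $ i $ j) \<and> 1 v* S = 1"

text \<open>In the lexicographic order, nonnegativity of a dual entry restricts its infinitesimal part only
  where the standard part vanishes.\<close>

definition feasible_direction :: "real^'n^'n \<Rightarrow> real^'n^'n \<Rightarrow> bool" where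
  "feasible_direction S B \<longleftrightarrow> (\<forall>i j. S $ i $ j = 0 \<longrightarrow> 0 \<le> B $ i $ j) \<and> 1 v* B = 0"

text \<open>Column \<open>j\<close> is the unit vector at \<open>f j\<close>. Matrices with one-hot columns correspond to arbitrary
  maps \<open>f\<close>, permutation matrices to bijections, and identical one-hot columns to constant maps.\<close>

definition selection_matrix :: "('n \<Rightarrow> 'n) \<Rightarrow> real^'n^'n" where
  "selection_matrix f = (\<chi> i j. if i = f j then 1 else 0)"

definition uniform_matrix :: "real^'n^'n" where
  "uniform_matrix = (1 / real CARD('n)) *\<^sub>R outer 1 1"

lemma std_inf_sum:
  "std_part (sum f A) = (\<Sum>x\<in>A. std_part (f x))" "inf_part (sum f A) = (\<Sum>x\<in>A. inf_part (f x))"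
  by (induction A rule: infinite_finite_induct) (auto simp: zero_dual_def plus_dual_def)

lemma ones_mult: "(1 v* (X :: 'a::comm_semiring_1^'n^'m)) $ j = (\<Sum>i\<in>UNIV. X $ i $ j)"
  by (simp add: vector_matrix_mult_def)

lemma is_dtpm_iff:
  "is_dtpm P \<longleftrightarrow> col_stochastic (std_mat P) \<and> feasible_direction (std_mat P) (inf_mat P)"
proof -
  have "P $ i $ j \<ge> 0 \<longleftrightarrow>
      std_part (P $ i $ j) \<ge> 0 \<and> (std_part (P $ i $ j) = 0 \<longrightarrow> inf_part (P $ i $ j) \<ge> 0)" for i j
    by (auto simp: less_eq_dual_def less_dual_def zero_dual_def dual_eq_iff)
  moreover have "1 v* P = 1 \<longleftrightarrow> 1 v* std_mat P = 1 \<and> 1 v* inf_mat P = 0"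
    by (auto simp: vec_eq_iff ones_mult dual_eq_iff std_inf_sum one_dual_def)
  ultimately show ?thesis
    by (auto simp: is_dtpm_def col_stochastic_def feasible_direction_def)
qed

lemma std_mat_dual_mat [simp]: "std_mat (dual_mat A B) = A"
  and inf_mat_dual_mat [simp]: "inf_mat (dual_mat A B) = B"
  by (simp_all add: vec_eq_iff dual_mat_def)

lemma eq_dual_mat_iff: "P = dual_mat A B \<longleftrightarrow> std_mat P = A \<and> inf_mat P = B"
  by (auto simp: vec_eq_iff dual_mat_def dual_eq_iff)

lemma feasible_direction_zero: "feasible_direction S 0"
  by (simp add: feasible_direction_def vec_eq_iff ones_mult)

lemma ones_inner_mult: "1 \<bullet> (X *v y) = (1 v* X) \<bullet> (y :: real^'n)"
  by (simp add: dot_lmul_matrix)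

lemma ones_inner_ones: "(1 :: real^'n) \<bullet> 1 = real CARD('n)"
  by (simp add: inner_vec_def)

lemma norm_ones: "norm (1 :: real^'n) = sqrt (real CARD('n))"
  by (simp add: norm_eq_sqrt_inner ones_inner_ones)

lemma selection_matrix_stochastic: "col_stochastic (selection_matrix f)"
  by (auto simp: col_stochastic_def selection_matrix_def vec_eq_iff ones_mult)

lemma selection_matrix_inner: "selection_matrix f \<bullet> B = (\<Sum>j\<in>UNIV. B $ f j $ j)"
proof -
  have "selection_matrix f \<bullet> B = (\<Sum>i\<in>UNIV. \<Sum>j\<in>UNIV. if i = f j then B $ i $ j else 0)"
    by (simp add: inner_vec_def selection_matrix_def if_distrib[of "\<lambda>a. a * _"] cong: if_cong)
  also have "\<dots> = (\<Sum>j\<in>UNIV. \<Sum>i\<in>UNIV. if i = f j then B $ i $ j else 0)"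
    by (rule sum.swap)
  finally show ?thesis by simp
qed

lemma norm_selection_matrix: "norm (selection_matrix f :: real^'n^'n) = sqrt (real CARD('n))"
  by (simp add: norm_eq_sqrt_inner selection_matrix_inner)
     (simp add: selection_matrix_def)

text \<open>The entries lie in \<open>[0, 1]\<close> and add up to \<open>n\<close>, so the sum of their squares is at most \<open>n\<close>.
  Equality makes every entry \<open>0\<close> or \<open>1\<close>, and then the column sums leave a single \<open>1\<close> per column.\<close>

lemma col_stochastic_frobenius:
  fixes S :: "real^'n^'n"
  assumes "col_stochastic S"
  shows "(norm S)\<^sup>2 \<le> real CARD('n)"
    and "(norm S)\<^sup>2 = real CARD('n) \<Longrightarrow> \<exists>f. S = selection_matrix f"
proof -
  have nonneg: "0 \<le> S $ i $ j" for i j using assms by (simp add: col_stochastic_def)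
  have col: "(\<Sum>i\<in>UNIV. S $ i $ j) = 1" for j
    using assms by (simp add: col_stochastic_def vec_eq_iff ones_mult)
  have "S $ i $ j \<le> (\<Sum>i\<in>UNIV. S $ i $ j)" for i j
    by (rule member_le_sum) (auto simp: nonneg)
  then have le1: "S $ i $ j \<le> 1" for i j by (simp add: col)
  have F: "(norm S)\<^sup>2 = (\<Sum>i\<in>UNIV. \<Sum>j\<in>UNIV. (S $ i $ j)\<^sup>2)"
    unfolding power2_norm_eq_inner by (simp add: inner_vec_def power2_eq_square)
  have "(\<Sum>i\<in>UNIV. \<Sum>j\<in>UNIV. S $ i $ j) = (\<Sum>j\<in>UNIV. \<Sum>i\<in>UNIV. S $ i $ j)"
    by (rule sum.swap)
  then have N: "(\<Sum>i\<in>UNIV. \<Sum>j\<in>UNIV. S $ i $ j) = real CARD('n)" by (simp add: col)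
  have gap: "real CARD('n) - (norm S)\<^sup>2 = (\<Sum>i\<in>UNIV. \<Sum>j\<in>UNIV. S $ i $ j * (1 - S $ i $ j))"
    unfolding F N[symmetric] by (simp add: power2_eq_square algebra_simps sum_subtractf)
  have term_nonneg: "0 \<le> S $ i $ j * (1 - S $ i $ j)" for i j
    using nonneg le1 by (intro mult_nonneg_nonneg) auto
  have "0 \<le> (\<Sum>i\<in>UNIV. \<Sum>j\<in>UNIV. S $ i $ j * (1 - S $ i $ j))"
    by (intro sum_nonneg term_nonneg)
  then show "(norm S)\<^sup>2 \<le> real CARD('n)" using gap by simp
  assume "(norm S)\<^sup>2 = real CARD('n)"
  then have "(\<Sum>i\<in>UNIV. \<Sum>j\<in>UNIV. S $ i $ j * (1 - S $ i $ j)) = 0" using gap by simp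
  then have "S $ i $ j * (1 - S $ i $ j) = 0" for i j
    by (simp add: sum_nonneg_eq_0_iff sum_nonneg term_nonneg)
  then have bin: "S $ i $ j = 0 \<or> S $ i $ j = 1" for i j by (metis eq_iff_diff_eq_0 mult_eq_0_iff)
  have "\<exists>i. S $ i $ j = 1" for j
    using col[of j] bin by (metis sum.neutral zero_neq_one)
  then obtain f where f: "S $ f j $ j = 1" for j by metis
  have "S $ i $ j = 0" if "i \<noteq> f j" for i j
  proof -
    have "(\<Sum>i\<in>UNIV - {f j}. S $ i $ j) = 0"
      using col[of j] f[of j] by (simp add: sum.remove[of UNIV "f j"])
    then show ?thesis
      using that by (simp add: sum_nonneg_eq_0_iff nonneg)
  qed
  then have "S = selection_matrix f" using f by (simp add: vec_eq_iff selection_matrix_def)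
  then show "\<exists>f. S = selection_matrix f" by blast
qed

text \<open>Off the support of the selection matrix a feasible direction is nonnegative. As its column sums
  vanish, it is nonpositive on the support, and the inner product adds up exactly these entries. If
  they all vanish, so does the rest of each column.\<close>

lemma selection_matrix_feasible_direction:
  fixes f :: "'n::finite \<Rightarrow> 'n"
  assumes "feasible_direction (selection_matrix f) B"
  shows "selection_matrix f \<bullet> B \<le> 0"
    and "selection_matrix f \<bullet> B = 0 \<Longrightarrow> B = 0"
proof -
  have nonneg: "0 \<le> B $ i $ j" if "i \<noteq> f j" for i j
    using assms that by (simp add: feasible_direction_def selection_matrix_def)
  have sum0: "B $ f j $ j + (\<Sum>i\<in>UNIV - {f j}. B $ i $ j) = 0" for j
    using assms by (simp add: feasible_direction_def vec_eq_iff ones_mult sum.remove[of UNIV "f j"])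
  have rest: "(\<Sum>i\<in>UNIV - {f j}. B $ i $ j) \<ge> 0" for j
    by (rule sum_nonneg) (simp add: nonneg)
  have nonpos: "B $ f j $ j \<le> 0" for j using sum0[of j] rest[of j] by linarith
  then show "selection_matrix f \<bullet> B \<le> 0"
    by (simp add: selection_matrix_inner sum_nonpos)
  assume "selection_matrix f \<bullet> B = 0"
  then have "(\<Sum>j\<in>UNIV. - B $ f j $ j) = 0"
    by (simp add: selection_matrix_inner sum_negf)
  then have diag: "B $ f j $ j = 0" for j
    using nonpos by (simp add: sum_nonneg_eq_0_iff)
  then have "(\<Sum>i\<in>UNIV - {f j}. B $ i $ j) = 0" for j using sum0[of j] by simp
  then have "B $ i $ j = 0" if "i \<noteq> f j" for i j
    using that sum_nonneg_eq_0_iff[of "UNIV - {f j}" "\<lambda>i. B $ i $ j"] nonneg by auto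
  then show "B = 0" using diag by (metis vec_eq_iff zero_index)
qed

lemma selection_matrix_orthogonal_iff:
  "transpose (selection_matrix f) ** selection_matrix f = mat 1 \<longleftrightarrow> inj f"
proof -
  have "(transpose (selection_matrix f) ** selection_matrix f) $ j $ k = (if f j = f k then 1 else 0 :: real)"
    for j k
    by (simp add: matrix_matrix_mult_def transpose_def selection_matrix_def
        if_distrib[of "\<lambda>a. a * _"] cong: if_cong)
  then show ?thesis
    by (auto simp: vec_eq_iff mat_def inj_def split: if_splits)
qed

lemma is_permutation_matrix_iff:
  fixes S :: "real^'n^'n"
  shows "is_permutation_matrix S \<longleftrightarrow>
    (\<exists>f. S = selection_matrix f) \<and> transpose S ** S = mat 1"
proof -
  have "\<pi> permutes UNIV \<longleftrightarrow> inj \<pi>" for \<pi> :: "'n \<Rightarrow> 'n"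
    using permutes_inj[of \<pi> UNIV] finite_UNIV_inj_surj[of \<pi>]
    by (auto intro!: bij_imp_permutes simp: bij_def)
  then show ?thesis
    unfolding is_permutation_matrix_def
    by (metis selection_matrix_def selection_matrix_orthogonal_iff)
qed

text \<open>The bilinear form of \<open>X\<close> is tested on the all-ones vector, on both sides.\<close>

lemma schatten_norm_infinity_ge_1:
  fixes X :: "real^'n^'n"
  assumes "1 v* X = 1"
  shows "1 \<le> schatten_norm \<infinity> X"
proof -
  have "real CARD('n) = 1 \<bullet> (X *v 1)"
    by (simp add: ones_inner_mult assms ones_inner_ones)
  also have "\<dots> \<le> schatten_norm \<infinity> X * norm (1 :: real^'n) * norm (1 :: real^'n)"
    by (rule bilinear_le_schatten_norm_infinity)
  also have "\<dots> = schatten_norm \<infinity> X * real CARD('n)"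
    by (simp add: norm_ones)
  finally show ?thesis by simp
qed

lemma schatten_norm_ge_1:
  fixes X :: "real^'n^'n"
  assumes "1 \<le> p" "1 v* X = 1"
  shows "1 \<le> schatten_norm p X"
  using schatten_norm_infinity_ge_1[OF assms(2)] schatten_norm_infinity_le[OF assms(1)]
  by (rule order_trans)

lemma ones_mult_line:
  fixes S B :: "real^'n^'n"
  assumes "1 v* S = 1" "1 v* B = 0"
  shows "1 v* (S + t *\<^sub>R B) = 1"
  using assms by (simp add: vec_eq_iff ones_mult sum.distrib flip: sum_distrib_left)

section \<open>The uniform matrix\<close>

lemma uniform_matrix_mult: "uniform_matrix *v x = ((1 \<bullet> x) / real CARD('n)) *\<^sub>R (1 :: real^'n)"
  by (simp add: uniform_matrix_def outer_mult flip: scaleR_matrix_vector_assoc)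

lemma inner_uniform_matrix: "A \<bullet> uniform_matrix = ((1 v* A) \<bullet> 1) / real CARD('n)"
  for A :: "real^'n^'n"
  by (simp add: uniform_matrix_def inner_outer dot_lmul_matrix inner_commute[of "A *v 1"])

lemma uniform_matrix_stochastic: "col_stochastic (uniform_matrix :: real^'n^'n)"
  by (simp add: col_stochastic_def vec_eq_iff ones_mult uniform_matrix_def outer_def)

lemma norm_uniform_matrix: "norm (uniform_matrix :: real^'n^'n) = 1"
  using uniform_matrix_stochastic[where 'n = 'n]
  by (simp add: norm_eq_1 inner_uniform_matrix col_stochastic_def ones_inner_ones)

lemma feasible_direction_uniform: "feasible_direction uniform_matrix B \<longleftrightarrow> 1 v* B = 0"
  by (simp add: feasible_direction_def uniform_matrix_def outer_def)

lemma schatten_norm_uniform_matrix: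
  assumes "1 \<le> p"
  shows "schatten_norm p (uniform_matrix :: real^'n^'n) = 1"
proof (rule antisym)
  let ?J = "uniform_matrix :: real^'n^'n"
  have ones: "1 v* ?J = 1" using uniform_matrix_stochastic[where 'n = 'n] by (simp add: col_stochastic_def)
  show "1 \<le> schatten_norm p ?J" using assms ones by (rule schatten_norm_ge_1)
  show "schatten_norm p ?J \<le> 1"
  proof (cases p rule: ereal_cases)
    case (real r)
    with assms have r: "r \<ge> 1" by simp
    have "schatten_norm (ereal r) ?J powr r \<le> 1 powr r"
      using schatten_norm_powr_le_excess[of r ?J] r schatten_norm_infinity_ge_1[OF ones]
      by (simp add: norm_uniform_matrix)
    then show ?thesis
      unfolding real by (rule powr_le_imp_le) (use r in \<open>simp_all add: schatten_norm_nonneg\<close>)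
  next
    case PInf
    then show ?thesis
      using schatten_norm_le_frobenius[of \<infinity> ?J] by (simp add: norm_uniform_matrix)
  qed (use assms in auto)
qed

text \<open>The operator norm is squeezed to \<open>1\<close> as well, so \<open>S\<close> has a single nonzero singular value, equal to
  \<open>1\<close>, and Frobenius norm \<open>1\<close>. Its inner product with the uniform matrix, also of norm \<open>1\<close>, is
  \<open>1\<close>: this is the equality case of Cauchy-Schwarz.\<close>

lemma schatten_norm_eq_1_imp_uniform:
  fixes S :: "real^'n^'n"
  assumes "1 \<le> p" "1 v* S = 1" "schatten_norm (ereal p) S = 1"
  shows "S = uniform_matrix"
proof -
  have "1 \<le> schatten_norm \<infinity> S" by (rule schatten_norm_infinity_ge_1) fact
  moreover have "schatten_norm \<infinity> S \<le> 1"
    using schatten_norm_infinity_le[of "ereal p" S] assms by simp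
  ultimately have "schatten_norm \<infinity> S = 1" by simp
  then have "norm S = 1"
    using schatten_norm_le_infinity_imp[of p S] assms by simp
  then have "(S - uniform_matrix) \<bullet> (S - uniform_matrix) = 0"
    using norm_uniform_matrix[where 'n = 'n]
    by (simp add: inner_diff_left inner_diff_right inner_commute[of uniform_matrix S]
        inner_uniform_matrix[of S] assms(2) ones_inner_ones norm_eq_1)
  then show ?thesis by simp
qed

section \<open>Maximizers\<close>

lemma has_max_maximizers:
  assumes "\<And>x. S x \<Longrightarrow> f x \<le> c" "S x0" "f x0 = c"
  shows "has_max f S c" "is_arg_max f S x \<longleftrightarrow> S x \<and> f x = c"
  using assms unfolding has_max_def is_arg_max_def by (metis leD order_le_less)+

lemma has_min_minimizers:
  assumes "\<And>x. S x \<Longrightarrow> c \<le> f x" "S x0" "f x0 = c"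
  shows "has_min f S c" "is_arg_min f S x \<longleftrightarrow> S x \<and> f x = c"
  using assms unfolding has_min_def is_arg_min_def by (metis leD order_le_less)+

lemma dual_schatten_norm_eq:
  "dual_schatten_norm p P =
     Dual (schatten_norm p (std_mat P)) (gateaux_derivative (schatten_norm p) (std_mat P) (inf_mat P))"
  by (simp add: dual_schatten_norm_def dual_continuation_def)

text \<open>The dual part of the argument is the same for all exponents. At the real maximizers \<open>E\<close>, which
  are selection matrices, the derivative is a positive multiple of \<open>S \<bullet> B\<close>; along feasible
  directions this is nonpositive and vanishes only for \<open>B = 0\<close>. In the lexicographic order all
  other standard parts lose.\<close>

lemma dual_schatten_norm_maximum:
  fixes E :: "real^'n^'n \<Rightarrow> bool"
  assumes bound: "\<And>S :: real^'n^'n. col_stochastic S \<Longrightarrow> schatten_norm p S \<le> c"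
    and eq: "\<And>S. col_stochastic S \<Longrightarrow> schatten_norm p S = c \<longleftrightarrow> E S"
    and selection: "\<And>S. E S \<Longrightarrow> \<exists>f. S = selection_matrix f"
    and deriv: "\<And>S B. E S \<Longrightarrow> gateaux_derivative (schatten_norm p) S B = k * (S \<bullet> B)" and k: "k > 0"
    and ex: "E S0"
  shows "has_max (dual_schatten_norm p) (is_dtpm :: dual^'n^'n \<Rightarrow> bool) (Dual c 0)"
    and "is_arg_max (dual_schatten_norm p) is_dtpm P \<longleftrightarrow> is_dtpm P \<and> E (std_mat P) \<and> inf_mat P = 0"
proof -
  have E0: "dual_schatten_norm p P = Dual c 0" if "is_dtpm P" "E (std_mat P)" "inf_mat P = 0" for P
    using that eq by (simp add: dual_schatten_norm_eq is_dtpm_iff gateaux_derivative_zero)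
  have main: "dual_schatten_norm p P \<le> Dual c 0 \<and>
      (dual_schatten_norm p P = Dual c 0 \<longrightarrow> E (std_mat P) \<and> inf_mat P = 0)" if P: "is_dtpm P" for P
  proof (cases "E (std_mat P)")
    case True
    then obtain f where f: "std_mat P = selection_matrix f" using selection by blast
    have feas: "feasible_direction (selection_matrix f) (inf_mat P)"
      using P f by (simp add: is_dtpm_iff)
    have c: "schatten_norm p (std_mat P) = c" using P True eq by (simp add: is_dtpm_iff)
    have "k * (std_mat P \<bullet> inf_mat P) \<le> 0"
      using selection_matrix_feasible_direction(1)[OF feas] k f by (simp add: mult_nonneg_nonpos)
    moreover have "inf_mat P = 0" if "k * (std_mat P \<bullet> inf_mat P) = 0"
      using selection_matrix_feasible_direction(2)[OF feas] that k f by simp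
    ultimately show ?thesis
      using c True by (auto simp: dual_schatten_norm_eq deriv less_eq_dual_def less_dual_def)
  next
    case False
    then have "schatten_norm p (std_mat P) < c"
      using P bound[of "std_mat P"] eq[of "std_mat P"] by (force simp: is_dtpm_iff)
    then show ?thesis by (simp add: dual_schatten_norm_eq less_eq_dual_def less_dual_def)
  qed
  have stoch: "col_stochastic S0"
    using selection[OF ex] selection_matrix_stochastic by auto
  have "is_dtpm (dual_mat S0 0)" using stoch by (simp add: is_dtpm_iff feasible_direction_zero)
  note max = has_max_maximizers[where S = is_dtpm and f = "dual_schatten_norm p" and c = "Dual c 0",
      OF _ this E0[OF this]]
  show "has_max (dual_schatten_norm p) (is_dtpm :: dual^'n^'n \<Rightarrow> bool) (Dual c 0)"
    using main ex by (intro max(1)) auto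
  have "is_arg_max (dual_schatten_norm p) is_dtpm P \<longleftrightarrow> is_dtpm P \<and> dual_schatten_norm p P = Dual c 0"
    using main ex by (intro max(2)) auto
  then show "is_arg_max (dual_schatten_norm p) is_dtpm P \<longleftrightarrow> is_dtpm P \<and> E (std_mat P) \<and> inf_mat P = 0"
    using main E0 by blast
qed

text \<open>The tangent bound compares \<open>S\<close> with an orthogonal matrix: its right-hand side is at most \<open>n\<close>
  because the squared Frobenius norm is. Equality forces a selection matrix and an orthogonal one,
  hence a permutation matrix.\<close>

lemma schatten_norm_stochastic_less_2:
  fixes S :: "real^'n^'n"
  assumes "col_stochastic S" "1 \<le> p" "p < 2"
  shows "schatten_norm (ereal p) S \<le> real CARD('n) powr (1 / p)"
    and "schatten_norm (ereal p) S = real CARD('n) powr (1 / p) \<longleftrightarrow> is_permutation_matrix S"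
proof -
  have root: "schatten_norm (ereal p) S = (schatten_norm (ereal p) S powr p) powr (1 / p)"
    using assms by (simp add: powr_powr schatten_norm_nonneg)
  have "p / 2 * ((norm S)\<^sup>2 - real CARD('n)) \<le> 0"
    using col_stochastic_frobenius(1)[OF assms(1)] assms by (simp add: mult_nonneg_nonpos)
  then have le: "schatten_norm (ereal p) S powr p \<le> real CARD('n)"
    using schatten_norm_powr_upper(1)[of p S] assms by linarith
  then show "schatten_norm (ereal p) S \<le> real CARD('n) powr (1 / p)"
    using assms by (subst root, intro powr_mono2) auto
  show "schatten_norm (ereal p) S = real CARD('n) powr (1 / p) \<longleftrightarrow> is_permutation_matrix S"
  proof
    assume "schatten_norm (ereal p) S = real CARD('n) powr (1 / p)"
    then have eq: "schatten_norm (ereal p) S powr p = real CARD('n)"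
      using assms by (simp add: powr_powr)
    then have "0 \<le> p / 2 * ((norm S)\<^sup>2 - real CARD('n))"
      using schatten_norm_powr_upper(1)[of p S] assms by linarith
    then have F: "(norm S)\<^sup>2 = real CARD('n)"
      using col_stochastic_frobenius(1)[OF assms(1)] assms by (simp add: zero_le_mult_iff)
    then have "transpose S ** S = mat 1"
      using schatten_norm_powr_upper(2)[of p S] assms eq by simp
    then show "is_permutation_matrix S"
      using col_stochastic_frobenius(2)[OF assms(1) F] by (simp add: is_permutation_matrix_iff)
  next
    assume "is_permutation_matrix S"
    then show "schatten_norm (ereal p) S = real CARD('n) powr (1 / p)"
      using assms by (intro schatten_norm_orthogonal) (auto simp: is_permutation_matrix_iff)
  qed
qed

text \<open>The lower tangent bound, with the trace norm bounded below by pairing with the contraction \<open>S\<close>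
  itself, and the upper tangent bound agree up to a term of order \<open>t\<^sup>2\<close>.\<close>

lemma gateaux_derivative_schatten_orthogonal:
  fixes S :: "real^'n^'n"
  assumes "transpose S ** S = mat 1" "1 \<le> p" "p < 2"
  shows "gateaux_derivative (schatten_norm (ereal p)) S B = real CARD('n) powr (1 / p - 1) * (S \<bullet> B)"
proof (rule gateaux_derivative_squeeze)
  let ?n = "real CARD('n)"
  let ?c = "S \<bullet> B"
  \<comment> \<open>Below this threshold the base \<open>n + p t (S \<bullet> B)\<close> of the lower bound stays nonnegative.\<close>
  define e where "e = ?n / (p * (\<bar>?c\<bar> + 1))"
  show "e > 0" using assms by (simp add: e_def)
  have orth: "orthogonal_transformation ((*v) S)"
    using assms(1) by (simp add: orthogonal_transformation_matrix orthogonal_matrix)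
  have "S \<bullet> S = (\<Sum>i\<in>UNIV. (S *v axis i 1) \<bullet> (S *v axis i 1))"
    by (rule frobenius_inner_orthonormal[symmetric]) (simp add: orthonormal_family_def inner_axis_axis)
  also have "\<dots> = ?n"
    using orth by (simp add: orthogonal_transformation_def inner_axis_axis)
  finally have SS: "S \<bullet> S = ?n" .
  have root: "schatten_norm (ereal p) X = (schatten_norm (ereal p) X powr p) powr (1 / p)"
    for X :: "real^'n^'n"
    using assms by (simp add: powr_powr schatten_norm_nonneg)
  show "(?n + p * t * ?c + t\<^sup>2 * 0) powr (1 / p) \<le> schatten_norm (ereal p) (S + t *\<^sub>R B)"
    if t: "t > 0" "t < e" for t
  proof -
    have "t * (p * (\<bar>?c\<bar> + 1)) < ?n"
      using t assms by (simp add: e_def pos_less_divide_eq)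
    moreover have "- (p * t * ?c) \<le> t * (p * (\<bar>?c\<bar> + 1))"
    proof -
      have "p * t * (- ?c) \<le> p * t * (\<bar>?c\<bar> + 1)"
        using t assms by (intro mult_left_mono) auto
      then show ?thesis by (simp add: mult_ac)
    qed
    ultimately have pos: "0 \<le> ?n + p * t * ?c" by linarith
    have "?n + t * ?c \<le> schatten_norm 1 (S + t *\<^sub>R B)"
      using contraction_inner_le_schatten_norm_1[of S "S + t *\<^sub>R B"] orth
      by (simp add: inner_add_right SS orthogonal_transformation)
    then have "p * (t * ?c) \<le> p * (schatten_norm 1 (S + t *\<^sub>R B) - ?n)"
      using assms by (intro mult_left_mono) auto
    then have "?n + p * t * ?c \<le> schatten_norm (ereal p) (S + t *\<^sub>R B) powr p"
      using schatten_norm_powr_lower[OF assms(2), of "S + t *\<^sub>R B"] by simp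
    then show ?thesis
      using pos assms by (subst root, intro powr_mono2) auto
  qed
  show "schatten_norm (ereal p) (S + t *\<^sub>R B) \<le> (?n + p * t * ?c + t\<^sup>2 * (p / 2 * (B \<bullet> B))) powr (1 / p)"
    for t
  proof -
    have "(norm (S + t *\<^sub>R B))\<^sup>2 - ?n = 2 * t * ?c + t\<^sup>2 * (B \<bullet> B)"
      unfolding power2_norm_eq_inner
      by (simp add: inner_add_left inner_add_right SS inner_commute[of B S] power2_eq_square
          algebra_simps)
    then have "schatten_norm (ereal p) (S + t *\<^sub>R B) powr p \<le> ?n + p / 2 * (2 * t * ?c + t\<^sup>2 * (B \<bullet> B))"
      using schatten_norm_powr_upper(1)[OF assms(2,3), of "S + t *\<^sub>R B"] by simp
    also have "\<dots> = ?n + p * t * ?c + t\<^sup>2 * (p / 2 * (B \<bullet> B))"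
      by (simp add: algebra_simps)
    finally show ?thesis
      using assms by (subst root, intro powr_mono2) auto
  qed
  have "schatten_norm (ereal p) S = ?n powr (1 / p)"
    using assms by (intro schatten_norm_orthogonal) auto
  then show "((\<lambda>t. ((?n + p * t * ?c + t\<^sup>2 * 0) powr (1 / p) - schatten_norm (ereal p) S) / t)
      \<longlongrightarrow> ?n powr (1 / p - 1) * ?c) (at_right 0)"
    "((\<lambda>t. ((?n + p * t * ?c + t\<^sup>2 * (p / 2 * (B \<bullet> B))) powr (1 / p) - schatten_norm (ereal p) S) / t)
      \<longlongrightarrow> ?n powr (1 / p - 1) * ?c) (at_right 0)"
    using assms powr_root_slope[of ?n p ?c 0] powr_root_slope[of ?n p ?c "p / 2 * (B \<bullet> B)"] by simp_all
qed

lemma gateaux_derivative_norm: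
  fixes S B :: "'a::real_inner"
  assumes "S \<noteq> 0"
  shows "gateaux_derivative norm S B = (S \<bullet> B) / norm S"
  by (rule gateaux_derivativeI) (rule norm_gateaux_derivative_tendsto[OF assms])

text \<open>The left and right singular vectors of the rank-one matrix \<open>S\<close> are \<open>axis i 1\<close> and the normalized
  all-ones vector; their bilinear form bounds the operator norm from below.\<close>

lemma schatten_norm_constant_selection_line:
  fixes i :: "'n::finite" and B :: "real^'n^'n"
  assumes "1 \<le> p"
  defines "S \<equiv> selection_matrix (\<lambda>_. i)"
  shows "sqrt (real CARD('n)) + t * (S \<bullet> B) / sqrt (real CARD('n)) \<le> schatten_norm p (S + t *\<^sub>R B)"
proof -
  let ?n = "real CARD('n)"
  have "axis i 1 \<bullet> (X *v 1) = S \<bullet> X" for X :: "real^'n^'n"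
    unfolding S_def by (simp add: selection_matrix_inner inner_axis' matrix_vector_mult_def)
  moreover have "S \<bullet> S = ?n"
    unfolding S_def by (simp add: selection_matrix_inner) (simp add: selection_matrix_def)
  ultimately have "?n + t * (S \<bullet> B) = axis i 1 \<bullet> ((S + t *\<^sub>R B) *v 1)"
    by (simp add: inner_add_right)
  also have "\<dots> \<le> schatten_norm \<infinity> (S + t *\<^sub>R B) * sqrt ?n"
    using bilinear_le_schatten_norm_infinity[of "axis i 1" "S + t *\<^sub>R B" 1] by (simp add: norm_ones)
  also have "\<dots> \<le> schatten_norm p (S + t *\<^sub>R B) * sqrt ?n"
    by (intro mult_right_mono schatten_norm_infinity_le assms) auto
  finally have "(?n + t * (S \<bullet> B)) / sqrt ?n \<le> schatten_norm p (S + t *\<^sub>R B)"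
    by (simp add: pos_divide_le_eq)
  then show ?thesis by (simp add: add_divide_distrib real_div_sqrt)
qed

lemma schatten_norm_constant_selection:
  fixes i :: "'n::finite"
  assumes "2 \<le> p"
  shows "schatten_norm p (selection_matrix (\<lambda>_. i)) = sqrt (real CARD('n))"
proof (rule antisym)
  show "schatten_norm p (selection_matrix (\<lambda>_. i)) \<le> sqrt (real CARD('n))"
    using schatten_norm_le_frobenius[OF assms] norm_selection_matrix by metis
  have "1 \<le> p" using assms by (rule order_trans[rotated]) simp
  then show "sqrt (real CARD('n)) \<le> schatten_norm p (selection_matrix (\<lambda>_. i))"
    using schatten_norm_constant_selection_line[of p 0 i 0] by simp
qed

text \<open>Every exponent \<open>p > 2\<close> is squeezed between the operator norm, bounded below by a linear function
  of \<open>t\<close>, and the Frobenius norm; at a matrix of rank one both have the same slope.\<close>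

lemma gateaux_derivative_schatten_constant_selection:
  fixes i :: "'n::finite"
  assumes "2 < p"
  defines "S \<equiv> selection_matrix (\<lambda>_. i)"
  shows "gateaux_derivative (schatten_norm p) S B = (1 / sqrt (real CARD('n))) * (S \<bullet> B)"
proof (rule gateaux_derivative_squeeze)
  let ?n = "real CARD('n)"
  have p: "2 \<le> p" "1 \<le> p" using assms by (auto intro: order_trans[of 1 2])
  show "sqrt ?n + t * (S \<bullet> B) / sqrt ?n \<le> schatten_norm p (S + t *\<^sub>R B)" for t
    unfolding S_def by (rule schatten_norm_constant_selection_line) fact
  show "(1::real) > 0" by simp
  show "schatten_norm p (S + t *\<^sub>R B) \<le> norm (S + t *\<^sub>R B)" for t
    by (rule schatten_norm_le_frobenius) fact
  have S: "schatten_norm p S = sqrt ?n" "norm S = sqrt ?n"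
    unfolding S_def using p by (simp_all add: schatten_norm_constant_selection norm_selection_matrix)
  have "\<forall>\<^sub>F t in at_right 0. (1 / sqrt ?n) * (S \<bullet> B) = (sqrt ?n + t * (S \<bullet> B) / sqrt ?n - schatten_norm p S) / t"
    by (intro eventually_at_rightI[of 0 1]) (auto simp: S)
  then show "((\<lambda>t. (sqrt ?n + t * (S \<bullet> B) / sqrt ?n - schatten_norm p S) / t)
      \<longlongrightarrow> (1 / sqrt ?n) * (S \<bullet> B)) (at_right 0)"
    by (rule tendsto_eventually[OF eventually_mono]) simp
  have "S \<noteq> 0" using S(2) by auto
  then show "((\<lambda>t. (norm (S + t *\<^sub>R B) - schatten_norm p S) / t) \<longlongrightarrow> (1 / sqrt ?n) * (S \<bullet> B)) (at_right 0)"
    using norm_gateaux_derivative_tendsto[of S B] by (simp add: S)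
qed

text \<open>Equality makes the Frobenius norm maximal, so the columns are one-hot, and equal to the operator
  norm, so the rank is one. Columns of a rank-one matrix are proportional, and proportional one-hot
  vectors coincide.\<close>

lemma schatten_norm_stochastic_greater_2:
  fixes S :: "real^'n^'n"
  assumes "col_stochastic S" "2 < p"
  shows "schatten_norm p S \<le> sqrt (real CARD('n))"
    and "schatten_norm p S = sqrt (real CARD('n)) \<longleftrightarrow> (\<exists>i. S = selection_matrix (\<lambda>_. i))"
proof -
  have p: "2 \<le> p" using assms by simp
  have F: "schatten_norm p S \<le> norm S" using p by (rule schatten_norm_le_frobenius)
  have N: "norm S \<le> sqrt (real CARD('n))"
    using col_stochastic_frobenius(1)[OF assms(1)] by (intro real_le_rsqrt)
  show "schatten_norm p S \<le> sqrt (real CARD('n))" using F N by simp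
  show "schatten_norm p S = sqrt (real CARD('n)) \<longleftrightarrow> (\<exists>i. S = selection_matrix (\<lambda>_. i))"
  proof
    assume eq: "schatten_norm p S = sqrt (real CARD('n))"
    then have nS: "norm S = sqrt (real CARD('n))" using F N by simp
    then obtain f where f: "S = selection_matrix f"
      using col_stochastic_frobenius(2)[OF assms(1)] by auto
    have "schatten_norm \<infinity> S = norm S"
      using assms(2) eq nS by (intro schatten_norm_eq_frobenius_imp) auto
    then obtain x where "norm x = 1" "norm (S *v x) = norm S"
      using schatten_norm_infinity_attained[of S] by metis
    then have rank_one: "S = outer (S *v x) x" by (rule rank_one_if_frobenius_attained)
    define y where "y = S *v x"
    have prod: "S $ i $ j = y $ i * x $ j" for i j
      by (subst rank_one) (simp add: outer_def y_def)
    have entry: "S $ i $ j = (if i = f j then 1 else 0)" for i j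
      by (simp add: f selection_matrix_def)
    have "f j = f k" for j k
    proof -
      have "y $ f j * x $ j = 1" "y $ f k * x $ k = 1"
        using prod entry by (metis (full_types))+
      then have "S $ f j $ k \<noteq> 0" unfolding prod by auto
      then show ?thesis by (simp add: entry split: if_splits)
    qed
    then have "f = (\<lambda>_. f undefined)" by auto
    then show "\<exists>i. S = selection_matrix (\<lambda>_. i)" using f by metis
  next
    assume "\<exists>i. S = selection_matrix (\<lambda>_. i)"
    then show "schatten_norm p S = sqrt (real CARD('n))"
      using schatten_norm_constant_selection[OF p] by auto
  qed
qed

section \<open>Minimizers\<close>

text \<open>The uniform matrix has norm \<open>1\<close> for all exponents, and derivative \<open>0\<close> in the direction \<open>0\<close>. So in
  the lexicographic order only the sign of the derivative at matrices of norm \<open>1\<close> is at stake.\<close>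

lemma dual_schatten_norm_minimum:
  assumes p: "1 \<le> p"
    and deriv: "\<And>S B :: real^'n^'n. 1 v* S = 1 \<Longrightarrow> 1 v* B = 0 \<Longrightarrow> schatten_norm p S = 1 \<Longrightarrow>
      0 \<le> gateaux_derivative (schatten_norm p) S B"
  shows "has_min (dual_schatten_norm p) (is_dtpm :: dual^'n^'n \<Rightarrow> bool) (Dual 1 0)"
    and "is_arg_min (dual_schatten_norm p) is_dtpm (P :: dual^'n^'n) \<longleftrightarrow>
      is_dtpm P \<and> dual_schatten_norm p P = Dual 1 0"
proof -
  have bound: "Dual 1 0 \<le> dual_schatten_norm p P" if "is_dtpm P" for P :: "dual^'n^'n"
  proof -
    have P: "1 v* std_mat P = 1" "1 v* inf_mat P = 0"
      using that by (auto simp: is_dtpm_iff col_stochastic_def feasible_direction_def)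
    then show ?thesis
      using schatten_norm_ge_1[OF p P(1)] deriv[OF P]
      by (auto simp: dual_schatten_norm_eq less_eq_dual_def less_dual_def)
  qed
  let ?P = "dual_mat uniform_matrix 0 :: dual^'n^'n"
  have "is_dtpm ?P"
    by (simp add: is_dtpm_iff uniform_matrix_stochastic feasible_direction_zero)
  moreover have "dual_schatten_norm p ?P = Dual 1 0"
    by (simp add: dual_schatten_norm_eq schatten_norm_uniform_matrix[OF p] gateaux_derivative_zero)
  ultimately show "has_min (dual_schatten_norm p) (is_dtpm :: dual^'n^'n \<Rightarrow> bool) (Dual 1 0)"
    "is_arg_min (dual_schatten_norm p) is_dtpm P \<longleftrightarrow> is_dtpm P \<and> dual_schatten_norm p P = Dual 1 0"
    using has_min_minimizers[of is_dtpm "Dual 1 0" "dual_schatten_norm p", OF bound] by blast+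
qed

text \<open>The line \<open>S + t B\<close> keeps the column sums \<open>1\<close>, so the norm never drops below its initial value
  \<open>1\<close>, and convexity guarantees the limit.\<close>

lemma gateaux_derivative_convex_nonneg:
  fixes S B :: "real^'n^'n"
  assumes "convex_on UNIV (schatten_norm p :: real^'n^'n \<Rightarrow> real)" "1 \<le> p"
    "1 v* S = 1" "1 v* B = 0" "schatten_norm p S = 1"
  shows "0 \<le> gateaux_derivative (schatten_norm p) S B"
  using schatten_norm_ge_1[OF assms(2) ones_mult_line[OF assms(3,4)]] assms(5)
  by (intro convex_gateaux_derivative_ge[OF assms(1), where e = 1]) auto

lemma
  fixes B :: "real^'n^'n"
  assumes "1 v* B = 0"
  shows uniform_inner_zero: "uniform_matrix \<bullet> B = 0"
    and norm_uniform_line: "(norm (uniform_matrix + t *\<^sub>R B))\<^sup>2 = 1 + t\<^sup>2 * (norm B)\<^sup>2"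
    and ones_uniform_line: "1 v* (uniform_matrix + t *\<^sub>R B) = 1"
proof -
  show *: "uniform_matrix \<bullet> B = 0"
    using assms by (subst inner_commute) (simp add: inner_uniform_matrix)
  have "(uniform_matrix :: real^'n^'n) \<bullet> uniform_matrix = 1"
    using norm_uniform_matrix[where 'n = 'n] by (simp add: norm_eq_1)
  then show "(norm (uniform_matrix + t *\<^sub>R B))\<^sup>2 = 1 + t\<^sup>2 * (norm B)\<^sup>2"
    unfolding power2_norm_eq_inner
    by (simp add: inner_add_left inner_add_right * inner_commute[of B uniform_matrix] power2_eq_square)
  show "1 v* (uniform_matrix + t *\<^sub>R B) = 1"
    using uniform_matrix_stochastic[where 'n = 'n] assms by (intro ones_mult_line) (auto simp: col_stochastic_def)
qed

text \<open>Along the line the norm is at least \<open>1\<close>, and the Frobenius norm is \<open>sqrt (1 + O(t\<^sup>2))\<close> because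
  \<open>B\<close> is orthogonal to the uniform matrix.\<close>

lemma gateaux_derivative_uniform_frobenius:
  fixes B :: "real^'n^'n"
  assumes "1 \<le> p" "1 v* B = 0"
    and "\<And>t. schatten_norm p (uniform_matrix + t *\<^sub>R B) \<le> norm (uniform_matrix + t *\<^sub>R B)"
  shows "gateaux_derivative (schatten_norm p) uniform_matrix B = 0"
proof (rule gateaux_derivative_squeeze)
  let ?J = "uniform_matrix :: real^'n^'n"
  show "1 \<le> schatten_norm p (?J + t *\<^sub>R B)" for t
    by (intro schatten_norm_ge_1 ones_uniform_line assms)
  show "(1::real) > 0" by simp
  show "schatten_norm p (?J + t *\<^sub>R B) \<le> norm (?J + t *\<^sub>R B)" for t by fact
  show "((\<lambda>t. (1 - schatten_norm p ?J) / t) \<longlongrightarrow> 0) (at_right 0)"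
    by (simp add: schatten_norm_uniform_matrix assms)
  have "?J \<noteq> 0" using norm_uniform_matrix[where 'n = 'n] by auto
  from norm_gateaux_derivative_tendsto[OF this, of B]
  show "((\<lambda>t. (norm (?J + t *\<^sub>R B) - schatten_norm p ?J) / t) \<longlongrightarrow> 0) (at_right 0)"
    by (simp add: schatten_norm_uniform_matrix norm_uniform_matrix uniform_inner_zero assms)
qed

text \<open>For \<open>p < 2\<close> the Frobenius norm does not bound the Schatten norm, but the bound by the excess over
  \<open>1\<close> does, and it serves every finite \<open>p > 1\<close>.\<close>

lemma gateaux_derivative_uniform:
  fixes B :: "real^'n^'n"
  assumes "1 < p" "1 v* B = 0"
  shows "gateaux_derivative (schatten_norm p) uniform_matrix B = 0"
proof (cases p rule: ereal_cases)
  case PInf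
  then show ?thesis
    using assms by (intro gateaux_derivative_uniform_frobenius schatten_norm_le_frobenius) auto
next
  case (real r)
  with assms have r: "r > 1" by simp
  let ?J = "uniform_matrix :: real^'n^'n"
  let ?n = "real CARD('n)"
  \<comment> \<open>The summand \<open>1\<close> keeps \<open>b\<close> positive when \<open>B = 0\<close>.\<close>
  define b where "b = (norm B)\<^sup>2 + 1"
  have b: "b > 0" by (simp add: b_def add_nonneg_pos)
  show ?thesis
    unfolding real
  proof (rule gateaux_derivative_squeeze)
    have J: "schatten_norm (ereal r) ?J = 1"
      using r by (simp add: schatten_norm_uniform_matrix)
    have ge: "1 \<le> schatten_norm (ereal r) (?J + t *\<^sub>R B)" for t
      using r by (intro schatten_norm_ge_1 ones_uniform_line assms) auto
    then show "1 \<le> schatten_norm (ereal r) (?J + t *\<^sub>R B)" for t .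
    show "(1::real) > 0" by simp
    show "schatten_norm (ereal r) (?J + t *\<^sub>R B)
        \<le> (1 + t\<^sup>2 * b) powr (r / 2) + (?n * b powr (r / 2)) * t powr r" if t: "t > 0" for t
    proof -
      let ?X = "?J + t *\<^sub>R B"
      have F: "(norm ?X)\<^sup>2 \<le> 1 + t\<^sup>2 * b"
        by (simp add: norm_uniform_line[OF assms(2)] b_def mult_left_mono)
      have F1: "(norm ?X)\<^sup>2 \<ge> 1"
        by (simp add: norm_uniform_line[OF assms(2)])
      \<comment> \<open>As the norm is at least \<open>1\<close>, taking its \<open>r\<close>-th power only increases it.\<close>
      have "schatten_norm (ereal r) ?X \<le> schatten_norm (ereal r) ?X powr r"
        using r ge[of t] powr_mono[of 1 r "schatten_norm (ereal r) ?X"] by simp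
      also have "\<dots> \<le> ((norm ?X)\<^sup>2) powr (r / 2) + ?n * ((norm ?X)\<^sup>2 - 1) powr (r / 2)"
        using r by (intro schatten_norm_powr_le_excess schatten_norm_infinity_ge_1
            ones_uniform_line assms) auto
      also have "\<dots> \<le> (1 + t\<^sup>2 * b) powr (r / 2) + ?n * (t\<^sup>2 * b) powr (r / 2)"
        using F F1 r by (intro add_mono mult_left_mono powr_mono2) auto
      also have "(t\<^sup>2 * b) powr (r / 2) = b powr (r / 2) * t powr r"
        using t b by (simp add: powr_mult powr_powr flip: powr_numeral)
      finally show ?thesis by (simp add: mult_ac)
    qed
    show "((\<lambda>t. (1 - schatten_norm (ereal r) ?J) / t) \<longlongrightarrow> 0) (at_right 0)"
      by (simp add: J)
    show "((\<lambda>t. ((1 + t\<^sup>2 * b) powr (r / 2) + (?n * b powr (r / 2)) * t powr r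
        - schatten_norm (ereal r) ?J) / t) \<longlongrightarrow> 0) (at_right 0)"
      unfolding J using r b by (rule powr_perturbation_slope)
  qed
qed (use assms in auto)

text \<open>A matrix of rank at most one has at most one nonzero singular value, so all its Schatten norms
  agree. By duality it is enough to pair it with contractions.\<close>

lemma schatten_norm_1_outer_le: "schatten_norm 1 (outer y x) \<le> norm (outer y (x :: real^'n) :: real^'n^'n)"
proof -
  obtain W :: "real^'n^'n" where W: "\<And>x. norm (W *v x) \<le> norm x"
    "W \<bullet> outer y x = schatten_norm 1 (outer y x)"
    using schatten_norm_1_attained by blast
  have "(norm (outer y x :: real^'n^'n))\<^sup>2 = (norm x * norm y)\<^sup>2"
    by (simp add: power2_norm_eq_inner inner_outer outer_mult power_mult_distrib)
  then have "norm (outer y x :: real^'n^'n) = norm x * norm y"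
    by (simp add: power2_eq_iff_nonneg)
  moreover have "(W *v x) \<bullet> y \<le> norm x * norm y"
    using norm_cauchy_schwarz[of "W *v x" y] W(1)[of x] mult_right_mono[of "norm (W *v x)" "norm x" "norm y"]
    by simp
  ultimately show ?thesis using W(2) by (simp add: inner_outer)
qed

text \<open>The trace norm has a kink at the uniform matrix \<open>J\<close>. Let \<open>C = B (1 - J)\<close>. If \<open>C = 0\<close>, then
  \<open>B = w 1\<^sup>T\<close> and the line \<open>J + t B\<close> consists of matrices of rank at most one, where the trace norm
  is the smooth Frobenius norm. Otherwise \<open>J + C / norm C\<close> is a contraction, and pairing with it
  bounds the slope from below by \<open>norm C\<close>.\<close>

lemma gateaux_derivative_schatten_1_uniform:
  fixes B :: "real^'n^'n"
  assumes B: "1 v* B = 0"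
  shows "gateaux_derivative (schatten_norm 1) uniform_matrix B = 0 \<longleftrightarrow> (\<exists>w. B = outer w 1)"
proof
  let ?J = "uniform_matrix :: real^'n^'n"
  assume "\<exists>w. B = outer w 1"
  then obtain w where w: "B = outer w 1" by blast
  show "gateaux_derivative (schatten_norm 1) ?J B = 0"
  proof (rule gateaux_derivative_uniform_frobenius)
    fix t
    have "?J + t *\<^sub>R B = outer ((1 / real CARD('n)) *\<^sub>R 1 + t *\<^sub>R w) 1"
      by (simp add: w uniform_matrix_def outer_def vec_eq_iff)
    then show "schatten_norm 1 (?J + t *\<^sub>R B) \<le> norm (?J + t *\<^sub>R B)"
      by (simp add: schatten_norm_1_outer_le)
  qed (use B in auto)
next
  let ?J = "uniform_matrix :: real^'n^'n"
  assume deriv: "gateaux_derivative (schatten_norm 1) ?J B = 0"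
  \<comment> \<open>With this \<open>w\<close>, the matrix \<open>w 1\<^sup>T\<close> is \<open>B J\<close>.\<close>
  define w where "w = (1 / real CARD('n)) *\<^sub>R (B *v 1)"
  define C where "C = B - outer w 1"
  have C_mult: "C *v x = B *v (x - ?J *v x)" for x
    by (simp add: C_def w_def matrix_vector_mult_diff_rdistrib matrix_vector_mult_diff_distrib outer_mult
        uniform_matrix_mult matrix_vector_mult_scaleR)
  have J1: "?J *v 1 = 1" by (simp add: uniform_matrix_mult ones_inner_ones)
  have C1: "C *v 1 = 0" by (simp add: C_mult J1)
  have C_J: "C *v (?J *v x) = 0" for x
    by (simp add: uniform_matrix_mult[of x] matrix_vector_mult_scaleR C1)
  have ones_C: "1 \<bullet> (C *v x) = 0" for x
    by (simp add: C_mult ones_inner_mult B)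
  have "C = 0"
  proof (rule ccontr)
    assume "C \<noteq> 0"
    then have nC: "norm C > 0" by simp
    define W where "W = ?J + (1 / norm C) *\<^sub>R C"
    \<comment> \<open>\<open>J\<close> is the orthogonal projection onto the line of the all-ones vector, \<open>C\<close> kills that line,
      and its range is orthogonal to it: the two summands of \<open>W\<close> act on orthogonal pieces of \<open>x\<close>.\<close>
    have contraction: "norm (W *v x) \<le> norm x" for x
    proof (rule power2_le_imp_le)
      let ?u = "?J *v x"
      have u: "?u \<bullet> (C *v x) = 0" "?u \<bullet> (x - ?u) = 0"
        by (simp_all add: uniform_matrix_mult[of x] ones_C inner_diff_right ones_inner_ones)
      have "norm (C *v x) = norm (C *v (x - ?u))"
        by (simp add: matrix_vector_mult_diff_distrib C_J)
      also have "\<dots> \<le> norm C * norm (x - ?u)"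
        using schatten_norm_infinity_bound[of C "x - ?u"] schatten_norm_le_frobenius[of \<infinity> C]
        by (meson mult_right_mono norm_ge_zero order_trans ereal_less_eq(1))
      finally have "norm ((1 / norm C) *\<^sub>R (C *v x)) \<le> norm (x - ?u)"
        using nC by (simp add: field_simps)
      then have le: "(norm ((1 / norm C) *\<^sub>R (C *v x)))\<^sup>2 \<le> (norm (x - ?u))\<^sup>2"
        by (rule power_mono) simp
      have "(norm (W *v x))\<^sup>2 = (norm ?u)\<^sup>2 + (norm ((1 / norm C) *\<^sub>R (C *v x)))\<^sup>2"
        unfolding W_def matrix_vector_mult_add_rdistrib scaleR_matrix_vector_assoc[symmetric]
        using u(1) by (intro norm_add_Pythagorean) (simp add: orthogonal_def)
      also have "\<dots> \<le> (norm ?u)\<^sup>2 + (norm (x - ?u))\<^sup>2" using le by simp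
      also have "\<dots> = (norm (?u + (x - ?u)))\<^sup>2"
        using u(2) by (intro norm_add_Pythagorean[symmetric]) (simp add: orthogonal_def)
      finally show "(norm (W *v x))\<^sup>2 \<le> (norm x)\<^sup>2" by simp
    qed simp
    have "C \<bullet> B = C \<bullet> C"
    proof -
      have "B = C + outer w 1" by (simp add: C_def)
      then have "C \<bullet> B = C \<bullet> C + C \<bullet> outer w 1" by (metis inner_add_right)
      then show ?thesis by (simp add: inner_outer C1)
    qed
    then have CB: "C \<bullet> B = (norm C)\<^sup>2" by (simp add: power2_norm_eq_inner)
    have CJ: "C \<bullet> ?J = 0" by (simp add: uniform_matrix_def inner_outer C1)
    have JJ: "?J \<bullet> ?J = 1" using norm_uniform_matrix[where 'n = 'n] by (simp add: norm_eq_1)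
    have "W \<bullet> (?J + t *\<^sub>R B) = 1 + norm C * t" for t
      using nC by (simp add: W_def inner_add_left inner_add_right CJ JJ CB uniform_inner_zero[OF B]
          power2_eq_square)
    then have "1 + norm C * t \<le> schatten_norm 1 (?J + t *\<^sub>R B)" for t
      using contraction_inner_le_schatten_norm_1[of W "?J + t *\<^sub>R B"] contraction by simp
    then have "norm C \<le> gateaux_derivative (schatten_norm 1) ?J B"
      by (intro convex_gateaux_derivative_ge[OF convex_schatten_norm_1, where e = 1])
         (auto simp: schatten_norm_uniform_matrix)
    then show False using deriv nC by simp
  qed
  then show "\<exists>w. B = outer w 1" by (auto simp: C_def)
qed

lemma columns_one_hot_iff:
  fixes P :: "dual^'n^'n"
  shows "(\<forall>j. \<exists>x. one_hot x \<and> column j P = dual_vec x 0) \<longleftrightarrow>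
    is_dtpm P \<and> (\<exists>f. std_mat P = selection_matrix f) \<and> inf_mat P = 0"
proof
  assume "\<forall>j. \<exists>x. one_hot x \<and> column j P = dual_vec x 0"
  then have "\<forall>j. \<exists>k. \<forall>i. P $ i $ j = Dual (if i = k then 1 else 0) 0"
    by (simp add: one_hot_def column_def dual_vec_def vec_eq_iff) metis
  then obtain f where "\<And>i j. P $ i $ j = Dual (if i = f j then 1 else 0) 0" by metis
  then have "std_mat P = selection_matrix f" "inf_mat P = 0"
    by (simp_all add: vec_eq_iff selection_matrix_def)
  then show "is_dtpm P \<and> (\<exists>f. std_mat P = selection_matrix f) \<and> inf_mat P = 0"
    using selection_matrix_stochastic[of f] by (auto simp only: is_dtpm_iff feasible_direction_zero)
next
  assume P: "is_dtpm P \<and> (\<exists>f. std_mat P = selection_matrix f) \<and> inf_mat P = 0"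
  then obtain f where f: "std_mat P = selection_matrix f" by blast
  have "one_hot (axis (f j) 1 :: real^'n)" "column j P = dual_vec (axis (f j) 1) 0" for j
    using f P by (auto simp: one_hot_def column_def dual_vec_def selection_matrix_def axis_def
        vec_eq_iff dual_eq_iff)
  then show "\<forall>j. \<exists>x. one_hot x \<and> column j P = dual_vec x 0" by blast
qed

lemma columns_same_one_hot_iff:
  fixes P :: "dual^'n^'n"
  shows "(\<exists>x. one_hot x \<and> (\<forall>j. column j P = dual_vec x 0)) \<longleftrightarrow>
    is_dtpm P \<and> (\<exists>i. std_mat P = selection_matrix (\<lambda>_. i)) \<and> inf_mat P = 0"
proof
  assume *: "\<exists>x. one_hot x \<and> (\<forall>j. column j P = dual_vec x 0)"
  then have "\<exists>k. \<forall>i j. P $ i $ j = Dual (if i = k then 1 else 0) 0"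
    by (simp add: one_hot_def column_def dual_vec_def vec_eq_iff) metis
  then have "\<exists>i. std_mat P = selection_matrix (\<lambda>_. i)"
    by (auto simp: vec_eq_iff selection_matrix_def)
  moreover have "\<forall>j. \<exists>x. one_hot x \<and> column j P = dual_vec x 0" using * by blast
  ultimately show "is_dtpm P \<and> (\<exists>i. std_mat P = selection_matrix (\<lambda>_. i)) \<and> inf_mat P = 0"
    using columns_one_hot_iff[of P] by blast
next
  assume P: "is_dtpm P \<and> (\<exists>i. std_mat P = selection_matrix (\<lambda>_. i)) \<and> inf_mat P = 0"
  then obtain i where i: "std_mat P = selection_matrix (\<lambda>_. i)" by blast
  have "one_hot (axis i 1 :: real^'n)" "\<forall>j. column j P = dual_vec (axis i 1) 0"
    using i P by (auto simp: one_hot_def column_def dual_vec_def selection_matrix_def axis_def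
        vec_eq_iff dual_eq_iff)
  then show "\<exists>x. one_hot x \<and> (\<forall>j. column j P = dual_vec x 0)" by blast
qed

lemma maximizers_less_2:
  fixes P :: "dual^'n^'n"
  assumes "1 \<le> p" "p < 2"
  shows "has_max (dual_schatten_norm (ereal p)) (is_dtpm :: dual^'n^'n \<Rightarrow> bool)
      (Dual (real CARD('n) powr (1 / p)) 0)"
    and "is_arg_max (dual_schatten_norm (ereal p)) is_dtpm P \<longleftrightarrow> is_permutation_dtpm P"
proof -
  have "is_permutation_matrix (selection_matrix (id :: 'n \<Rightarrow> 'n))"
    by (auto simp: is_permutation_matrix_iff selection_matrix_orthogonal_iff)
  note max = dual_schatten_norm_maximum[where p = "ereal p" and E = is_permutation_matrix
      and c = "real CARD('n) powr (1 / p)" and k = "real CARD('n) powr (1 / p - 1)",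
      OF schatten_norm_stochastic_less_2(1)[OF _ assms] schatten_norm_stochastic_less_2(2)[OF _ assms]
        _ gateaux_derivative_schatten_orthogonal[OF _ assms] _ this]
  show "has_max (dual_schatten_norm (ereal p)) (is_dtpm :: dual^'n^'n \<Rightarrow> bool)
      (Dual (real CARD('n) powr (1 / p)) 0)"
    by (rule max(1)) (auto simp: is_permutation_matrix_iff)
  show "is_arg_max (dual_schatten_norm (ereal p)) is_dtpm P \<longleftrightarrow> is_permutation_dtpm P"
    unfolding is_permutation_dtpm_def
    by (rule max(2)) (auto simp: is_permutation_matrix_iff)
qed

lemma maximizers_2:
  fixes P :: "dual^'n^'n"
  shows "has_max (dual_schatten_norm 2) (is_dtpm :: dual^'n^'n \<Rightarrow> bool) (Dual (sqrt (real CARD('n))) 0)"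
    and "is_arg_max (dual_schatten_norm 2) is_dtpm P \<longleftrightarrow>
      (\<forall>j. \<exists>x. one_hot x \<and> column j P = dual_vec x 0)"
proof -
  let ?n = "real CARD('n)"
  have S2: "schatten_norm 2 = (norm :: real^'n^'n \<Rightarrow> real)"
    by (rule ext) (rule schatten_norm_2)
  have bound: "schatten_norm 2 S \<le> sqrt ?n" if "col_stochastic S" for S :: "real^'n^'n"
    unfolding S2 using col_stochastic_frobenius(1)[OF that] by (intro real_le_rsqrt)
  have eq: "schatten_norm 2 S = sqrt ?n \<longleftrightarrow> (\<exists>f. S = selection_matrix f)"
    if "col_stochastic S" for S :: "real^'n^'n"
    unfolding S2 using col_stochastic_frobenius(2)[OF that] norm_selection_matrix by auto
  have deriv: "gateaux_derivative (schatten_norm 2) S B = (1 / sqrt ?n) * (S \<bullet> B)"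
    if "\<exists>f. S = selection_matrix f" for S B :: "real^'n^'n"
  proof -
    have "norm S = sqrt ?n" using that norm_selection_matrix by auto
    moreover from this have "S \<noteq> 0" by auto
    ultimately show ?thesis unfolding S2 by (simp add: gateaux_derivative_norm)
  qed
  have ex: "\<exists>f. selection_matrix id = selection_matrix f" by blast
  note max = dual_schatten_norm_maximum[OF bound eq _ deriv _ ex]
  show "has_max (dual_schatten_norm 2) (is_dtpm :: dual^'n^'n \<Rightarrow> bool) (Dual (sqrt ?n) 0)"
    by (rule max(1)) auto
  show "is_arg_max (dual_schatten_norm 2) is_dtpm P \<longleftrightarrow>
      (\<forall>j. \<exists>x. one_hot x \<and> column j P = dual_vec x 0)"
    unfolding columns_one_hot_iff by (rule max(2)) auto
qed

lemma maximizers_greater_2: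
  fixes P :: "dual^'n^'n"
  assumes p: "2 < p"
  shows "has_max (dual_schatten_norm p) (is_dtpm :: dual^'n^'n \<Rightarrow> bool) (Dual (sqrt (real CARD('n))) 0)"
    and "is_arg_max (dual_schatten_norm p) is_dtpm P \<longleftrightarrow>
      (\<exists>x. one_hot x \<and> (\<forall>j. column j P = dual_vec x 0))"
proof -
  let ?n = "real CARD('n)"
  have deriv: "gateaux_derivative (schatten_norm p) S B = (1 / sqrt ?n) * (S \<bullet> B)"
    if "\<exists>i. S = selection_matrix (\<lambda>_. i)" for S B :: "real^'n^'n"
    using that gateaux_derivative_schatten_constant_selection[OF p] by blast
  have ex: "\<exists>i. selection_matrix (\<lambda>_. undefined) = selection_matrix (\<lambda>_. i)" by blast
  note max = dual_schatten_norm_maximum[OF schatten_norm_stochastic_greater_2(1)[OF _ p]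
      schatten_norm_stochastic_greater_2(2)[OF _ p] _ deriv _ ex]
  show "has_max (dual_schatten_norm p) (is_dtpm :: dual^'n^'n \<Rightarrow> bool) (Dual (sqrt ?n) 0)"
    by (rule max(1)) auto
  show "is_arg_max (dual_schatten_norm p) is_dtpm P \<longleftrightarrow>
      (\<exists>x. one_hot x \<and> (\<forall>j. column j P = dual_vec x 0))"
    unfolding columns_same_one_hot_iff by (rule max(2)) auto
qed

lemma is_dtpm_uniform:
  fixes P :: "dual^'n^'n"
  assumes "std_mat P = uniform_matrix"
  shows "is_dtpm P \<longleftrightarrow> 1 v* inf_mat P = 0"
  unfolding is_dtpm_iff assms by (simp add: uniform_matrix_stochastic feasible_direction_uniform)

lemma dual_schatten_norm_uniform_eq_1:
  assumes "std_mat P = uniform_matrix" "1 \<le> p"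
  shows "dual_schatten_norm p P = Dual 1 0 \<longleftrightarrow>
      gateaux_derivative (schatten_norm p) uniform_matrix (inf_mat P) = 0"
  unfolding dual_schatten_norm_eq assms(1) by (simp add: schatten_norm_uniform_matrix assms(2))

lemma dual_schatten_norm_eq_1_imp_uniform:
  assumes "is_dtpm P" "dual_schatten_norm (ereal r) P = Dual 1 0" "1 \<le> r"
  shows "std_mat P = uniform_matrix"
  by (rule schatten_norm_eq_1_imp_uniform[OF assms(3)])
     (use assms in \<open>simp_all add: is_dtpm_iff col_stochastic_def dual_schatten_norm_eq\<close>)

lemma minimizers_1:
  fixes P :: "dual^'n^'n"
  shows "has_min (dual_schatten_norm 1) (is_dtpm :: dual^'n^'n \<Rightarrow> bool) (Dual 1 0)"
    and "is_arg_min (dual_schatten_norm 1) is_dtpm P \<longleftrightarrow>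
      (\<exists>w. 1 \<bullet> w = 0 \<and> P = dual_mat uniform_matrix (outer w 1))"
proof -
  note min = dual_schatten_norm_minimum[where 'n = 'n,
      OF order_refl gateaux_derivative_convex_nonneg[OF convex_schatten_norm_1 order_refl]]
  show "has_min (dual_schatten_norm 1) (is_dtpm :: dual^'n^'n \<Rightarrow> bool) (Dual 1 0)"
    by (rule min(1))
  have sum_w: "1 v* (outer w 1 :: real^'n^'n) = 0 \<longleftrightarrow> 1 \<bullet> w = 0" for w :: "real^'n"
    by (simp add: vec_eq_iff ones_mult outer_def inner_vec_def)
  have "is_arg_min (dual_schatten_norm 1) is_dtpm P \<longleftrightarrow>
      is_dtpm P \<and> dual_schatten_norm 1 P = Dual 1 0"
    by (rule min(2))
  also have "\<dots> \<longleftrightarrow> std_mat P = uniform_matrix \<and> 1 v* inf_mat P = 0 \<and> dual_schatten_norm 1 P = Dual 1 0"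
    using dual_schatten_norm_eq_1_imp_uniform[of P 1] is_dtpm_uniform[of P]
    by (metis one_ereal_def order_refl)
  also have "\<dots> \<longleftrightarrow> std_mat P = uniform_matrix \<and> 1 v* inf_mat P = 0 \<and> (\<exists>w. inf_mat P = outer w 1)"
    using dual_schatten_norm_uniform_eq_1[of P 1] gateaux_derivative_schatten_1_uniform[of "inf_mat P"]
    by (metis order_refl)
  also have "\<dots> \<longleftrightarrow> (\<exists>w. 1 \<bullet> w = 0 \<and> P = dual_mat uniform_matrix (outer w 1))"
    unfolding eq_dual_mat_iff using sum_w by metis
  finally show "is_arg_min (dual_schatten_norm 1) is_dtpm P \<longleftrightarrow>
      (\<exists>w. 1 \<bullet> w = 0 \<and> P = dual_mat uniform_matrix (outer w 1))" .
qed

text \<open>For finite \<open>p\<close> only the uniform matrix has norm \<open>1\<close>. For \<open>p = \<infinity>\<close> and \<open>n \<ge> 2\<close> there are other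
  standard parts of norm \<open>1\<close>, such as the identity; there convexity shows that the derivative is
  still nonnegative.\<close>

lemma minimizers_greater_1:
  fixes P :: "dual^'n^'n"
  assumes p: "1 < p"
  shows "has_min (dual_schatten_norm p) (is_dtpm :: dual^'n^'n \<Rightarrow> bool) (Dual 1 0)"
    and "1 v* B = 0 \<Longrightarrow> P = dual_mat uniform_matrix B \<Longrightarrow> is_arg_min (dual_schatten_norm p) is_dtpm P"
    and "p \<noteq> \<infinity> \<Longrightarrow> is_arg_min (dual_schatten_norm p) is_dtpm P \<Longrightarrow>
      \<exists>B. 1 v* B = 0 \<and> P = dual_mat uniform_matrix B"
proof -
  have p1: "1 \<le> p" using p by simp
  have deriv: "0 \<le> gateaux_derivative (schatten_norm p) S B"
    if "1 v* S = 1" "1 v* B = 0" "schatten_norm p S = 1" for S B :: "real^'n^'n"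
  proof (cases p rule: ereal_cases)
    case PInf
    then show ?thesis
      using gateaux_derivative_convex_nonneg[OF convex_schatten_norm_infinity _ that(1,2)] that(3)
      by simp
  next
    case (real r)
    then have "S = uniform_matrix"
      using that p by (intro schatten_norm_eq_1_imp_uniform[of r]) auto
    then show ?thesis using gateaux_derivative_uniform[OF p that(2)] by simp
  qed (use p in auto)
  note min = dual_schatten_norm_minimum[OF p1 deriv]
  show "has_min (dual_schatten_norm p) (is_dtpm :: dual^'n^'n \<Rightarrow> bool) (Dual 1 0)"
    by (rule min(1))
  show "is_arg_min (dual_schatten_norm p) is_dtpm P"
    if B: "1 v* B = 0" and P: "P = dual_mat uniform_matrix B"
  proof -
    have S: "std_mat P = uniform_matrix" "inf_mat P = B" using P unfolding eq_dual_mat_iff by auto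
    have "is_dtpm P" using is_dtpm_uniform[OF S(1)] S(2) B by metis
    moreover have "dual_schatten_norm p P = Dual 1 0"
      using dual_schatten_norm_uniform_eq_1[OF S(1) p1] gateaux_derivative_uniform[OF p B] S(2) by metis
    ultimately show ?thesis by (simp add: min(2))
  qed
  show "\<exists>B. 1 v* B = 0 \<and> P = dual_mat uniform_matrix B"
    if "p \<noteq> \<infinity>" "is_arg_min (dual_schatten_norm p) is_dtpm P"
  proof -
    have P: "is_dtpm P" "dual_schatten_norm p P = Dual 1 0"
      using that(2) by (simp_all add: min(2))
    obtain r where r: "p = ereal r" "1 \<le> r"
      using p \<open>p \<noteq> \<infinity>\<close> by (cases p rule: ereal_cases) auto
    have S: "std_mat P = uniform_matrix"
      by (rule dual_schatten_norm_eq_1_imp_uniform[OF P(1) _ r(2)]) (use P(2) r(1) in simp)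
    then show ?thesis
      using is_dtpm_uniform[OF S] P(1) unfolding eq_dual_mat_iff by blast
  qed
qed

theorem proposition6p6:
  shows
    "(\<forall>p::real. 1 \<le> p \<and> p < 2 \<longrightarrow>
        has_max (dual_schatten_norm (ereal p)) (is_dtpm :: dual^'n^'n \<Rightarrow> bool)
          (Dual (real CARD('n) powr (1 / p)) 0) \<and>
        (\<forall>P :: dual^'n^'n. is_arg_max (dual_schatten_norm (ereal p)) is_dtpm P \<longleftrightarrow>
           is_permutation_dtpm P)) \<and>
     (has_max (dual_schatten_norm 2) (is_dtpm :: dual^'n^'n \<Rightarrow> bool)
        (Dual (real CARD('n) powr (1 / 2)) 0) \<and>
      (\<forall>P :: dual^'n^'n. is_arg_max (dual_schatten_norm 2) is_dtpm P \<longleftrightarrow>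
         (\<forall>j. \<exists>x. one_hot x \<and> column j P = dual_vec x 0))) \<and>
     (\<forall>p::ereal. 2 < p \<longrightarrow>
        has_max (dual_schatten_norm p) (is_dtpm :: dual^'n^'n \<Rightarrow> bool)
          (Dual (real CARD('n) powr (1 / 2)) 0) \<and>
        (\<forall>P :: dual^'n^'n. is_arg_max (dual_schatten_norm p) is_dtpm P \<longleftrightarrow>
           (\<exists>x. one_hot x \<and> (\<forall>j. column j P = dual_vec x 0)))) \<and>
     (has_min (dual_schatten_norm 1) (is_dtpm :: dual^'n^'n \<Rightarrow> bool) (Dual 1 0) \<and>
      (\<forall>P :: dual^'n^'n. is_arg_min (dual_schatten_norm 1) is_dtpm P \<longleftrightarrow>
         (\<exists>w. 1 \<bullet> w = 0 \<and>
            P = dual_mat ((1 / real CARD('n)) *\<^sub>R outer 1 1) (outer w 1)))) \<and>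
     (\<forall>p::ereal. 1 < p \<longrightarrow>
        has_min (dual_schatten_norm p) (is_dtpm :: dual^'n^'n \<Rightarrow> bool) (Dual 1 0) \<and>
        (\<forall>P :: dual^'n^'n.
           (\<exists>B. 1 v* B = 0 \<and> P = dual_mat ((1 / real CARD('n)) *\<^sub>R outer 1 1) B) \<longrightarrow>
           is_arg_min (dual_schatten_norm p) is_dtpm P) \<and>
        (p \<noteq> \<infinity> \<longrightarrow> (\<forall>P :: dual^'n^'n.
           is_arg_min (dual_schatten_norm p) is_dtpm P \<longrightarrow>
           (\<exists>B. 1 v* B = 0 \<and> P = dual_mat ((1 / real CARD('n)) *\<^sub>R outer 1 1) B))))"
  unfolding uniform_matrix_def[symmetric] powr_half_sqrt[OF of_nat_0_le_iff]
  by (intro conjI allI impI maximizers_2 minimizers_1)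
     (auto intro: maximizers_less_2 maximizers_greater_2 minimizers_greater_1
       simp: maximizers_less_2(2) maximizers_greater_2(2))

end
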